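(* Let $P=\{p,q\}$ be a matched pair and let $M=M_1\otimes\cdots\otimes M_n$ be a viable tensor product of nonzero homology classes of diagrams on the fragment $\mathcal{Z}_P$. Then, after possibly exchanging the names $p,q$, $M$ is an extension-contraction of one of the following tensor products of homology classes of diagrams (each diagram standing for its homology class), and the H-data (occupation of $P$ and on/off status) and tightness of $M$ are as listed for it: - unoccupied 00: tight: $e_0$. - unoccupied 11: tight: $e_1$. - pre-one-half-occupied 01: tight: $p_-$. - post-one-half-occupied 10: tight: $p_+$. - alternately occupied 00: singular: $q_-\otimes p_+$. - alternately occupied 11: tight: $p_+\otimes q_-$. - once occupied 00: tight: $p_-\otimes p_+$. - once occupied 11: twisted: $p_+\otimes p_-$. - pre-sesqui-occupied 01: tight: $p_-\otimes p_+\otimes q_-$; critical: $q_-\otimes p_+\otimes p_-$. - post-sesqui-occupied 10: tight: $q_+\otimes p_-\otimes p_+$; critical: $p_+\otimes p_-\otimes q_+$. - doubly occupied 00: tight: $p_-\otimes p_+\otimes q_-\otimes q_+$; critical: $p_-\otimes q_+\otimes q_-\otimes p_+$. - doubly occupied 11: tight: $p_+\otimes q_-\otimes q_+\otimes p_-$; critical: $p_+\otimes p_-\otimes q_+\otimes q_-$.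
   Context: All algebra is over $\mathbb{Z}_2$. The fragment $\mathcal{Z}_P$ is the arc diagram with two oriented intervals, one containing a single place $p$ in its interior and the other a single place $q$, with one matched pair $P=\{p,q\}$. Write $-\infty_p,+\infty_p$ and $-\infty_q,+\infty_q$ for the start and end points of the intervals through $p$ and $q$; the four steps are the parts before and after each place. Let $\mathbf{a}=\{p,q\}$, $E=\{\pm\infty_p,\pm\infty_q\}$. A strand diagram is $(S,T,\phi)$ with $S,T\subseteq\mathbf{a}\cup E$ and $\phi:S\to T$ a bijection with $\phi(x)\ge x$ along the intervals ($x$ and $\phi(x)$ on the same interval), thought of as strands $x\to\phi(x)$; crossings are inversions. The product of $(S,T,\phi)$ and $(U,V,\psi)$ is $(S,V,\psi\phi)$ if $T=U$ and $\mathrm{inv}(\psi\phi)=\mathrm{inv}(\phi)+\mathrm{inv}(\psi)$, else $0$; $\partial$ is the sum of all resolutions of one crossing lowering the number of crossings by exactly $1$. For $s\subseteq\{P\}$ let $I(s)=\sum_S I(S)$ (identity diagrams), over $S$ consisting of exactly one of $p,q$ if $P\in s$ (none if $P\notin s$) and any subset of $E$. For $\mu=(S,T,\phi)$ without fixed points let $a(\mu)=\sum_U(S\cup U,T\cup U,\phi_U)$ over $U\subseteq(\mathbf{a}\cup E)\setminus(S\cup T)$, $\phi_U$ extending $\phi$ by the identity. A diagram from $s$ to $t$ is a nonzero element $I(s)a(\mu)I(t)$; it is described by the strands of $\mu$ together with, when horizontal strands at $P$ occur, a dotted pair of horizontal strands at $p$ and $q$ (standing for the sum of the two choices). The strand algebra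 $\mathcal{A}=\mathcal{A}(\mathcal{Z}_P)$ is the DGA with basis the diagrams. The H-data of a diagram from $s$ to $t$ is $(h,s,t)$, $h$ being the sum of $[x,\phi(x)]$ (which steps are covered); $\mathcal{A}(h,s,t)$ is the span of diagrams with H-data $(h,s,t)$. A tensor product of classes $M_i$ of diagrams with H-data $(h_i,s_i,t_i)$ is viable if $t_i=s_{i+1}$ for all $i$ and $h=\sum h_i$ covers each step at most once; its H-data is $(h,s_1,t_n)$. Terminology for H-data $(h,s,t)$: $P$ is 00, 01, 10, 11, the first digit being $1$ iff $P\in s$, the second $1$ iff $P\in t$. A place is unoccupied if neither adjacent step is covered by $h$, pre-half-occupied (post-half-occupied) if only the step before (after) it is covered, half-occupied in either of these cases, fully occupied if both are. $P$ is: unoccupied if both places are; (pre-/post-)one-half-occupied if one place is (pre-/post-)half-occupied and the other unoccupied; alternately occupied if both are half-occupied; once occupied if one is fully occupied and the other unoccupied; (pre-/post-)sesqui-occupied if one is fully occupied and the other (pre-/post-)half-occupied; doubly occupied if both are fully occupied. Named diagrams: $e_0$: no strands; $e_1$: dotted horizontal pair only; $p_-$: one strand $-\infty_p\to p$; $p_+$: one strand $p\to+\infty_p$; similarly $q_\pm$. A diagram is tight if it has no crossings and is nonzero in homology, twisted if it has no crossings and is zero in homology, crossed if it has crossings. Let $M=M_1\otimes\cdots\otimes M_n$ be viable with H-data $(h,s,t)$, $M_i$ nonzero and represented by (tight) diagrams $D_i$. $M$ is tight if $D_1\cdots D_n$ is nonzero and tight; twisted if $D_1\cdots D_n$ is nonzero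 and twisted; critical if $D_1\cdots D_n=0$ but $\mathcal{A}(h,s,t)\neq0$; singular if $\mathcal{A}(h,s,t)=0$ (exactly one holds, independently of the $D_i$). An extension of a viable $M_1\otimes\cdots\otimes M_n$ inserts, at some position (possibly at either end), the class of the idempotent diagram ($e_0$ or $e_1$) matching the idempotents at that position. A contraction replaces a sub-product $M_i\otimes\cdots\otimes M_j$ by the single factor $M_i\cdots M_j$, provided this product in homology is nonzero. An extension-contraction is the result of any finite (possibly empty) sequence of extensions and contractions. *)

theory Defs
  imports Main "HOL-Library.Z2" "HOL-Library.Function_Algebras"
begin

section \<open>The arc diagram\<close>

datatype place = p | q

text \<open>
  The interval through a place \<open>x\<close> carries the three points
  \<open>Minus_inf x < At x < Plus_inf x\<close>.  The type of points is \<open>a \<union> E\<close>.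
\<close>

datatype point = Minus_inf place | At place | Plus_inf place

fun interval :: "point \<Rightarrow> place" where
  "interval (Minus_inf x) = x"
| "interval (At x) = x"
| "interval (Plus_inf x) = x"

fun level :: "point \<Rightarrow> nat" where
  "level (Minus_inf x) = 0"
| "level (At x) = 1"
| "level (Plus_inf x) = 2"

instantiation point :: order
begin

definition less_eq_point :: "point \<Rightarrow> point \<Rightarrow> bool" where
  "x \<le> y \<longleftrightarrow> interval x = interval y \<and> level x \<le> level y"

definition less_point :: "point \<Rightarrow> point \<Rightarrow> bool" where
  "x < y \<longleftrightarrow> interval x = interval y \<and> level x < level y"

instance
proof
  fix x y z :: point
  show "x < y \<longleftrightarrow> x \<le> y \<and> \<not> y \<le> x"
    by (auto simp: less_eq_point_def less_point_def)
  show "x \<le> x" by (simp add: less_eq_point_def)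
  show "x \<le> y \<Longrightarrow> y \<le> z \<Longrightarrow> x \<le> z"
    by (simp add: less_eq_point_def)
  show "x \<le> y \<Longrightarrow> y \<le> x \<Longrightarrow> x = y"
    by (cases x; cases y) (auto simp: less_eq_point_def)
qed

end

text \<open>Finiteness makes all the formal sums below genuine finite sums.\<close>

instance place :: finite
proof
  have "(UNIV :: place set) \<subseteq> {p, q}" by (auto intro: place.exhaust)
  then show "finite (UNIV :: place set)" by (rule finite_subset) simp
qed

instance point :: finite
proof
  have "x \<in> range Minus_inf \<union> range At \<union> range Plus_inf" for x
    by (cases x) auto
  then have "(UNIV :: point set) \<subseteq> range Minus_inf \<union> range At \<union> range Plus_inf"
    by blast
  then show "finite (UNIV :: point set)" by (rule finite_subset) simp
qed

definition P :: "point set" where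
  "P = {At p, At q}"

datatype step = Before place | After place

fun step_start :: "step \<Rightarrow> point" where
  "step_start (Before x) = Minus_inf x"
| "step_start (After x) = At x"

fun step_end :: "step \<Rightarrow> point" where
  "step_end (Before x) = At x"
| "step_end (After x) = Plus_inf x"


section \<open>Strand diagrams\<close>

text \<open>
  A strand diagram \<open>(S, T, \<phi>)\<close> is encoded by the partial map \<open>\<phi>\<close>, with \<open>S = dom \<phi>\<close> and
  \<open>T = ran \<phi>\<close>.
\<close>

type_synonym strands = "point \<rightharpoonup> point"

definition strand_diagram :: "strands \<Rightarrow> bool" where
  "strand_diagram \<phi> \<longleftrightarrow> inj_on \<phi> (dom \<phi>) \<and> (\<forall>x y. \<phi> x = Some y \<longrightarrow> x \<le> y)"

definition crossings :: "strands \<Rightarrow> (point \<times> point) set" where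
  "crossings \<phi> = {(x, y). \<exists>x' y'. \<phi> x = Some x' \<and> \<phi> y = Some y' \<and> x < y \<and> y' < x'}"

definition inv_num :: "strands \<Rightarrow> nat" where
  "inv_num \<phi> = card (crossings \<phi>)"

definition id_strands :: "point set \<Rightarrow> strands" where
  "id_strands U = Some |` U"

definition resolve :: "strands \<Rightarrow> point \<Rightarrow> point \<Rightarrow> strands" where
  "resolve \<phi> x y = \<phi>(x := \<phi> y, y := \<phi> x)"


section \<open>The ambient algebra of strand diagrams over the two-element field\<close>

type_synonym vec = "strands \<Rightarrow> bit"

definition basis :: "strands \<Rightarrow> vec" where
  "basis \<phi> = (\<lambda>\<psi>. if \<psi> = \<phi> then 1 else 0)"

definition supp :: "vec \<Rightarrow> strands set" where
  "supp X = {\<phi>. X \<phi> \<noteq> 0}"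

definition strands_mult :: "strands \<Rightarrow> strands \<Rightarrow> vec" where
  "strands_mult \<phi> \<psi> =
     (if ran \<phi> = dom \<psi> \<and> inv_num (\<psi> \<circ>\<^sub>m \<phi>) = inv_num \<phi> + inv_num \<psi>
      then basis (\<psi> \<circ>\<^sub>m \<phi>) else 0)"

definition mult :: "vec \<Rightarrow> vec \<Rightarrow> vec"  (infixl "\<odot>" 70) where
  "X \<odot> Y = (\<Sum>\<phi>\<in>supp X. \<Sum>\<psi>\<in>supp Y. strands_mult \<phi> \<psi>)"

definition strands_diff :: "strands \<Rightarrow> vec" where
  "strands_diff \<phi> =
     (\<Sum>(x, y) \<in> {(x, y) \<in> crossings \<phi>. inv_num (resolve \<phi> x y) + 1 = inv_num \<phi>}.
        basis (resolve \<phi> x y))"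

definition diff :: "vec \<Rightarrow> vec"  ("\<partial>") where
  "\<partial> X = (\<Sum>\<phi>\<in>supp X. strands_diff \<phi>)"

text \<open>Over the two-element field, linear combinations are sums of finite subsets.\<close>

definition span2 :: "vec set \<Rightarrow> vec set" where
  "span2 V = {\<Sum>F | F. finite F \<and> F \<subseteq> V}"


section \<open>Diagrams and the strand algebra\<close>

text \<open>An idempotent state is a subset \<open>s\<close> of \<open>{P}\<close>.\<close>

type_synonym idem = "point set set"

definition idempotent :: "idem \<Rightarrow> vec" where
  "idempotent s = (\<Sum>S \<in> {S. card (S \<inter> P) = (if P \<in> s then 1 else 0)}. basis (id_strands S))"

definition add_horizontals :: "strands \<Rightarrow> vec" where
  "add_horizontals \<mu> = (\<Sum>U \<in> Pow (- (dom \<mu> \<union> ran \<mu>)). basis (\<mu> ++ id_strands U))"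

definition diag :: "idem \<Rightarrow> strands \<Rightarrow> idem \<Rightarrow> vec" where
  "diag s \<mu> t = idempotent s \<odot> add_horizontals \<mu> \<odot> idempotent t"

definition homology_cover :: "strands \<Rightarrow> step \<Rightarrow> nat" where
  "homology_cover \<mu> \<sigma> = card {x. \<exists>y. \<mu> x = Some y \<and> x \<le> step_start \<sigma> \<and> step_end \<sigma> \<le> y}"

type_synonym hdata = "(step \<Rightarrow> nat) \<times> idem \<times> idem"

definition diagram_hdata :: "vec \<Rightarrow> hdata \<Rightarrow> bool" where
  "diagram_hdata D = (\<lambda>(h, s, t). s \<subseteq> {P} \<and> t \<subseteq> {P} \<and>
     (\<exists>\<mu>. strand_diagram \<mu> \<and> (\<forall>x. \<mu> x \<noteq> Some x) \<and>
          D = diag s \<mu> t \<and> D \<noteq> 0 \<and> h = homology_cover \<mu>))"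

definition is_diagram :: "vec \<Rightarrow> bool" where
  "is_diagram D \<longleftrightarrow> (\<exists>dat. diagram_hdata D dat)"

definition strand_algebra :: "vec set"  ("\<A>") where
  "\<A> = span2 {D. is_diagram D}"

definition summand :: "hdata \<Rightarrow> vec set" where
  "summand dat = span2 {D. diagram_hdata D dat}"


section \<open>Homology\<close>

definition cycles :: "vec set" where
  "cycles = {X \<in> \<A>. \<partial> X = 0}"

definition boundaries :: "vec set" where
  "boundaries = \<partial> ` \<A>"

text \<open>Homology classes are cosets of the boundaries in the cycles.\<close>

type_synonym hclass = "vec set"

definition hclass_of :: "vec \<Rightarrow> hclass" where
  "hclass_of X = {Y \<in> cycles. Y - X \<in> boundaries}"

definition hmult :: "hclass \<Rightarrow> hclass \<Rightarrow> hclass" where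
  "hmult M N = (\<Union>X\<in>M. \<Union>Y\<in>N. hclass_of (X \<odot> Y))"

text \<open>
  In a diagram with a dotted pair of horizontal strands, a strand crossing either dotted
  strand is a crossing; it is then visible in only one of the two choices, whence the
  existential quantifier.
\<close>

definition has_crossings :: "vec \<Rightarrow> bool" where
  "has_crossings D \<longleftrightarrow> (\<exists>\<phi>\<in>supp D. crossings \<phi> \<noteq> {})"

definition tight_diagram :: "vec \<Rightarrow> bool" where
  "tight_diagram D \<longleftrightarrow> is_diagram D \<and> \<not> has_crossings D \<and> hclass_of D \<noteq> hclass_of 0"

definition twisted_diagram :: "vec \<Rightarrow> bool" where
  "twisted_diagram D \<longleftrightarrow> is_diagram D \<and> \<not> has_crossings D \<and> hclass_of D = hclass_of 0"

definition class_hdata :: "hclass \<Rightarrow> hdata \<Rightarrow> bool" where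
  "class_hdata M dat \<longleftrightarrow> (\<exists>D. diagram_hdata D dat \<and> \<partial> D = 0 \<and> M = hclass_of D)"


section \<open>Tensor products of homology classes\<close>

text \<open>
  Over the two-element field an elementary tensor of nonzero vectors determines its factors,
  so tensor products of nonzero classes are encoded as nonempty lists.
\<close>

type_synonym tensor = "hclass list"

definition viable_with :: "tensor \<Rightarrow> hdata \<Rightarrow> bool" where
  "viable_with M = (\<lambda>(h, s, t). \<exists>ds. ds \<noteq> [] \<and> list_all2 class_hdata M ds \<and>
     (\<forall>i. Suc i < length ds \<longrightarrow> snd (snd (ds ! i)) = fst (snd (ds ! Suc i))) \<and>
     h = (\<lambda>\<sigma>. \<Sum>d\<leftarrow>ds. fst d \<sigma>) \<and> (\<forall>\<sigma>. h \<sigma> \<le> 1) \<and>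
     s = fst (snd (hd ds)) \<and> t = snd (snd (last ds)))"

definition viable :: "tensor \<Rightarrow> bool" where
  "viable M \<longleftrightarrow> (\<exists>dat. viable_with M dat)"

definition extension_step :: "tensor \<Rightarrow> tensor \<Rightarrow> bool" where
  "extension_step M M' \<longleftrightarrow> viable M \<and>
     (\<exists>xs ys u. M = xs @ ys \<and> u \<subseteq> {P} \<and>
        (xs \<noteq> [] \<longrightarrow> (\<exists>h s. class_hdata (last xs) (h, s, u))) \<and>
        (ys \<noteq> [] \<longrightarrow> (\<exists>h t. class_hdata (hd ys) (h, u, t))) \<and>
        M' = xs @ [hclass_of (diag u Map.empty u)] @ ys)"

definition hprod :: "tensor \<Rightarrow> hclass" where
  "hprod M = foldl hmult (hd M) (tl M)"

definition contraction_step :: "tensor \<Rightarrow> tensor \<Rightarrow> bool" where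
  "contraction_step M M' \<longleftrightarrow> viable M \<and>
     (\<exists>xs ys zs. M = xs @ ys @ zs \<and> ys \<noteq> [] \<and> hprod ys \<noteq> hclass_of 0 \<and> M' = xs @ [hprod ys] @ zs)"

text \<open>\<open>ext_contr N M\<close>: the tensor product \<open>M\<close> is an extension-contraction of \<open>N\<close>.\<close>

definition ext_contr :: "tensor \<Rightarrow> tensor \<Rightarrow> bool" where
  "ext_contr = (\<lambda>M M'. extension_step M M' \<or> contraction_step M M')\<^sup>*\<^sup>*"

definition represents :: "vec list \<Rightarrow> tensor \<Rightarrow> bool" where
  "represents Ds M \<longleftrightarrow> list_all2 (\<lambda>D X. tight_diagram D \<and> X = hclass_of D) Ds M"

definition dprod :: "vec list \<Rightarrow> vec" where
  "dprod Ds = foldl (\<odot>) (hd Ds) (tl Ds)"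

datatype tightness = Tight | Twisted | Critical | Singular

fun tightness_via :: "vec list \<Rightarrow> hdata \<Rightarrow> tightness \<Rightarrow> bool" where
  "tightness_via Ds dat Tight \<longleftrightarrow> dprod Ds \<noteq> 0 \<and> tight_diagram (dprod Ds)"
| "tightness_via Ds dat Twisted \<longleftrightarrow> dprod Ds \<noteq> 0 \<and> twisted_diagram (dprod Ds)"
| "tightness_via Ds dat Critical \<longleftrightarrow> dprod Ds = 0 \<and> summand dat \<noteq> {0}"
| "tightness_via Ds dat Singular \<longleftrightarrow> summand dat = {0}"

text \<open>
  The tightness does not depend on the choice of representatives; the definition asks for all
  choices, of which there is at least one.
\<close>

definition tensor_tightness :: "tensor \<Rightarrow> hdata \<Rightarrow> tightness \<Rightarrow> bool" where
  "tensor_tightness M dat \<tau> \<longleftrightarrow> viable_with M dat \<and> (\<exists>Ds. represents Ds M) \<and>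
     (\<forall>Ds. represents Ds M \<longrightarrow> tightness_via Ds dat \<tau>)"


section \<open>Occupation\<close>

definition unoccupied :: "(step \<Rightarrow> nat) \<Rightarrow> place \<Rightarrow> bool" where
  "unoccupied h x \<longleftrightarrow> h (Before x) = 0 \<and> h (After x) = 0"

definition pre_half_occupied :: "(step \<Rightarrow> nat) \<Rightarrow> place \<Rightarrow> bool" where
  "pre_half_occupied h x \<longleftrightarrow> h (Before x) \<noteq> 0 \<and> h (After x) = 0"

definition post_half_occupied :: "(step \<Rightarrow> nat) \<Rightarrow> place \<Rightarrow> bool" where
  "post_half_occupied h x \<longleftrightarrow> h (Before x) = 0 \<and> h (After x) \<noteq> 0"

definition half_occupied :: "(step \<Rightarrow> nat) \<Rightarrow> place \<Rightarrow> bool" where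
  "half_occupied h x \<longleftrightarrow> pre_half_occupied h x \<or> post_half_occupied h x"

definition fully_occupied :: "(step \<Rightarrow> nat) \<Rightarrow> place \<Rightarrow> bool" where
  "fully_occupied h x \<longleftrightarrow> h (Before x) \<noteq> 0 \<and> h (After x) \<noteq> 0"

datatype occupation =
    Unoccupied | Pre_one_half_occupied | Post_one_half_occupied | Alternately_occupied
  | Once_occupied | Pre_sesqui_occupied | Post_sesqui_occupied | Doubly_occupied

fun occupation_of_P :: "(step \<Rightarrow> nat) \<Rightarrow> occupation \<Rightarrow> bool" where
  "occupation_of_P h Unoccupied \<longleftrightarrow> (\<forall>x. unoccupied h x)"
| "occupation_of_P h Pre_one_half_occupied \<longleftrightarrow>
     (\<exists>x y. x \<noteq> y \<and> pre_half_occupied h x \<and> unoccupied h y)"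
| "occupation_of_P h Post_one_half_occupied \<longleftrightarrow>
     (\<exists>x y. x \<noteq> y \<and> post_half_occupied h x \<and> unoccupied h y)"
| "occupation_of_P h Alternately_occupied \<longleftrightarrow> (\<forall>x. half_occupied h x)"
| "occupation_of_P h Once_occupied \<longleftrightarrow>
     (\<exists>x y. x \<noteq> y \<and> fully_occupied h x \<and> unoccupied h y)"
| "occupation_of_P h Pre_sesqui_occupied \<longleftrightarrow>
     (\<exists>x y. x \<noteq> y \<and> fully_occupied h x \<and> pre_half_occupied h y)"
| "occupation_of_P h Post_sesqui_occupied \<longleftrightarrow>
     (\<exists>x y. x \<noteq> y \<and> fully_occupied h x \<and> post_half_occupied h y)"
| "occupation_of_P h Doubly_occupied \<longleftrightarrow> (\<forall>x. fully_occupied h x)"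

text \<open>The digits of the on/off status are rendered as booleans, \<open>True\<close> standing for 1.\<close>

fun has_hdata_type :: "hdata \<Rightarrow> occupation \<Rightarrow> bool \<times> bool \<Rightarrow> bool" where
  "has_hdata_type (h, s, t) occ st \<longleftrightarrow> occupation_of_P h occ \<and> st = (P \<in> s, P \<in> t)"


section \<open>Named diagrams\<close>

definition e0 :: vec where
  "e0 = diag {} Map.empty {}"

definition e1 :: vec where
  "e1 = diag {P} Map.empty {P}"

text \<open>\<open>minus_strand x\<close> and \<open>plus_strand x\<close> are the diagrams written with subscripts
  \<open>-\<close> and \<open>+\<close> on the place \<open>x\<close>.\<close>

definition minus_strand :: "place \<Rightarrow> vec" where
  "minus_strand x = diag {} [Minus_inf x \<mapsto> At x] {P}"

definition plus_strand :: "place \<Rightarrow> vec" where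
  "plus_strand x = diag {P} [At x \<mapsto> Plus_inf x] {}"

end

theory Submission
  imports Defs
begin

text \<open>
  On each of the two intervals a strand diagram has one of seven local types, and products,
  crossings and the differential are computed locally: the sums of strand diagrams with prescribed
  types multiply by a small partial table.  There are 22 diagrams.  The boundaries are spanned by the
  two once-occupied diagrams with a strand before and a strand after one place, and by one sum of two
  diagrams covering all four steps; so 17 diagrams are tight.  Every tight diagram is a product of
  the one-strand diagrams, each homology class being the product of their classes, so a viable tensor
  product is obtained from a word in the four one-strand diagrams by one extension or contraction
  per factor.  Each letter occurs at most once and raises or lowers the idempotent, so only few
  words remain, and the product of the letters decides tightness.
\<close>

section \<open>Linear algebra over the two-element field\<close>

text \<open>Types multiply without cancellation because a strand diagram is recovered from its two
  local types and its domain: each composite then arises from exactly one pair of factors, so a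
  product of two type sums is a type sum or zero. Products of homology classes range over all
  representatives, and no general statement that boundaries form an ideal is proved. Instead,
  \<open>D\<close> can be preceded and followed only by \<open>N1\<close>; since \<open>N1\<close>
  is absent from the one-strand diagrams, from the partial products of their words and from the
  spanning boundaries, all mixed products vanish exactly. Two tight diagrams, of types
  \<open>D\<close>, \<open>C0\<close> and \<open>C0\<close>, \<open>D\<close>, share their homology
  class, so a class does not determine its diagram. Independence of the representatives survives
  because such a diagram covers all four steps, which forces every other factor of a viable tensor
  to be idempotent. Critical and singular words are separated by the idempotents: when the pair is
  off at both ends, every moving strand runs along a whole interval, so a half-covered interval
  carries no diagram.\<close>

lemma vec_add_self [simp]: "X + X = (0 :: vec)"
  by (simp add: fun_eq_iff)

lemma vec_diff_eq_add: "X - Y = (X + Y :: vec)"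
  by (simp add: fun_eq_iff)

lemma vec_add_self_left [simp]: "X + (X + Y) = (Y :: vec)"
  by (simp flip: add.assoc)

lemma vec_add_eq_zero_iff: "X + Y = 0 \<longleftrightarrow> X = (Y :: vec)"
  by (metis vec_diff_eq_add right_minus_eq)

lemma sum_vec_apply: "(\<Sum>i\<in>I. f i) \<phi> = (\<Sum>i\<in>I. f i \<phi> :: bit)" for f :: "'i \<Rightarrow> vec"
  by (induction I rule: infinite_finite_induct) auto

definition lin :: "(strands \<Rightarrow> vec) \<Rightarrow> vec \<Rightarrow> vec" where
  "lin f X = (\<Sum>\<phi>\<in>supp X. f \<phi>)"

lemma lin_UNIV: "lin f X = (\<Sum>\<phi>\<in>UNIV. if X \<phi> = 1 then f \<phi> else 0)"
  unfolding lin_def supp_def by (subst sum.inter_filter [symmetric]) auto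

lemma lin_add: "lin f (X + Y) = lin f X + lin f Y"
  unfolding lin_UNIV sum.distrib [symmetric] by (rule sum.cong) (auto simp: vec_add_eq_zero_iff)

lemma lin_zero [simp]: "lin f 0 = 0"
  by (simp add: lin_UNIV)

lemma lin_basis: "lin f (basis \<phi>) = f \<phi>"
proof -
  have "supp (basis \<phi>) = {\<phi>}" by (auto simp: supp_def basis_def)
  then show ?thesis by (simp add: lin_def)
qed

lemma lin_fun_add: "lin (\<lambda>\<phi>. f \<phi> + g \<phi>) X = lin f X + lin g X"
  by (simp add: lin_def sum.distrib)

definition ind :: "strands set \<Rightarrow> vec" where
  "ind S = (\<lambda>\<phi>. if \<phi> \<in> S then 1 else 0)"

lemma supp_ind [simp]: "supp (ind S) = S"
  by (auto simp: supp_def ind_def)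

lemma ind_eq_sum: "ind S = (\<Sum>\<phi>\<in>S. basis \<phi>)"
proof
  fix \<phi>
  show "ind S \<phi> = (\<Sum>\<psi>\<in>S. basis \<psi>) \<phi>"
    unfolding sum_vec_apply basis_def ind_def by simp
qed

lemma ind_supp: "ind (supp X) = X"
  by (auto simp: fun_eq_iff ind_def supp_def)

lemma lin_ind: "lin f (ind S) = (\<Sum>\<phi>\<in>S. f \<phi>)"
  by (simp add: lin_def)

lemma sum_basis_image: "inj_on f A \<Longrightarrow> (\<Sum>a\<in>A. basis (f a)) = ind (f ` A)"
  by (simp add: ind_eq_sum sum.reindex)

lemma supp_add: "supp (X + Y) \<subseteq> supp X \<union> supp Y"
  by (auto simp: supp_def)

text \<open>Over the two-element field a vector is the sum of the basis vectors of its support, so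
  bilinear identities reduce to basis vectors.\<close>

lemma vec_supp_induct [consumes 1, case_names zero add]:
  assumes "supp X \<subseteq> S" "Q 0"
    and "\<And>\<phi> Y. \<phi> \<in> S \<Longrightarrow> supp Y \<subseteq> S \<Longrightarrow> Q Y \<Longrightarrow> Q (basis \<phi> + Y)"
  shows "Q X"
proof -
  have "Q (ind F)" if "F \<subseteq> S" for F
    using finite[of F] that
  proof (induction F)
    case empty
    have "ind {} = 0" by (simp add: ind_def fun_eq_iff)
    with assms(2) show ?case by metis
  next
    case (insert \<phi> F)
    then have "ind (insert \<phi> F) = basis \<phi> + ind F" by (simp add: ind_eq_sum)
    moreover have "Q (basis \<phi> + ind F)"
      using insert by (intro assms(3)) auto
    ultimately show ?case by metis
  qed
  from this[OF assms(1)] show ?thesis by (simp add: ind_supp)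
qed

lemma mult_lin: "X \<odot> Y = lin (\<lambda>\<phi>. lin (strands_mult \<phi>) Y) X"
  by (simp add: mult_def lin_def)

lemma mult_add_left: "(X + Y) \<odot> Z = X \<odot> Z + Y \<odot> Z"
  by (simp add: mult_lin lin_add)

lemma mult_add_right: "X \<odot> (Y + Z) = X \<odot> Y + X \<odot> Z"
  by (simp add: mult_lin lin_add lin_fun_add)

lemma mult_zero_left [simp]: "0 \<odot> X = 0"
  by (simp add: mult_lin)

lemma mult_zero_right [simp]: "X \<odot> 0 = 0"
  by (simp add: mult_lin) (simp add: lin_def)

lemma mult_basis: "basis \<phi> \<odot> basis \<psi> = strands_mult \<phi> \<psi>"
  by (simp add: mult_lin lin_basis)

lemma diff_lin: "\<partial> X = lin strands_diff X"
  by (simp add: diff_def lin_def)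

lemma diff_add: "\<partial> (X + Y) = \<partial> X + \<partial> Y"
  by (simp add: diff_lin lin_add)

lemma diff_zero [simp]: "\<partial> 0 = 0"
  by (simp add: diff_lin)

lemma span2_zero: "0 \<in> span2 V"
  unfolding span2_def by (rule CollectI, rule exI[of _ "{}"]) simp

lemma span2_base: "X \<in> V \<Longrightarrow> X \<in> span2 V"
  unfolding span2_def by (rule CollectI, rule exI[of _ "{X}"]) simp

text \<open>Elements common to both finite sets cancel, so the two sums add up to the sum over the
  symmetric difference, again a set without repetitions.\<close>

lemma span2_add:
  assumes "X \<in> span2 V" "Y \<in> span2 V"
  shows "X + Y \<in> span2 V"
proof -
  obtain F G where F: "finite F" "F \<subseteq> V" "X = \<Sum>F" and G: "finite G" "G \<subseteq> V" "Y = \<Sum>G"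
    using assms by (auto simp: span2_def)
  have "\<Sum>F = \<Sum>(F - G) + \<Sum>(F \<inter> G)" and "\<Sum>G = \<Sum>(G - F) + \<Sum>(F \<inter> G)"
    using sum.Int_Diff[of F id G] sum.Int_Diff[of G id F] F G by (auto simp: add.commute Int_commute)
  then have "X + Y = (\<Sum>(F - G) + \<Sum>(F \<inter> G)) + (\<Sum>(G - F) + \<Sum>(F \<inter> G))"
    using F G by simp
  also have "\<dots> = \<Sum>(F - G) + \<Sum>(G - F)"
    by (simp only: add.assoc add.left_commute[of _ "\<Sum>(G - F)"] vec_add_self add_0_right) (rule add.commute)
  also have "\<dots> = \<Sum>((F - G) \<union> (G - F))"
    using F G by (intro sum.union_disjoint [symmetric]) auto
  finally show ?thesis
    using F G unfolding span2_def by (intro CollectI exI[of _ "(F - G) \<union> (G - F)"]) auto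
qed

lemma span2_subset:
  assumes "V \<subseteq> W" "0 \<in> W" "\<And>X Y. X \<in> W \<Longrightarrow> Y \<in> W \<Longrightarrow> X + Y \<in> W"
  shows "span2 V \<subseteq> W"
proof -
  have "\<Sum>F \<in> W" if "finite F" "F \<subseteq> V" for F
    using that by induction (use assms in auto)
  then show ?thesis by (auto simp: span2_def)
qed

lemma all_place: "(\<forall>x. Q x) \<longleftrightarrow> Q p \<and> Q q"
  by (metis place.exhaust)

lemma ex_place: "(\<exists>x. Q x) \<longleftrightarrow> Q p \<or> Q q"
  by (metis place.exhaust)

section \<open>Local types of strand diagrams\<close>

text \<open>
  The shape of a strand diagram on one interval, up to horizontal strands at the endpoints: no
  moving strand (\<open>N\<close>), a strand ending (\<open>A\<close>) or starting (\<open>B\<close>) at the place, a strand along the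
  whole interval (\<open>C\<close>), or one strand before and one after the place (\<open>D\<close>).  The digits of \<open>N\<close> and
  \<open>C\<close> count the horizontal strands at the place.
\<close>

datatype ltype = N0 | N1 | A | B | C0 | C1 | D

definition local_type :: "strands \<Rightarrow> place \<Rightarrow> ltype" where
  "local_type \<phi> x =
    (if \<phi> (Minus_inf x) = Some (At x) then (if \<phi> (At x) = None then A else D)
     else if \<phi> (Minus_inf x) = Some (Plus_inf x) then (if \<phi> (At x) = None then C0 else C1)
     else if \<phi> (At x) = Some (Plus_inf x) then B
     else if \<phi> (At x) = None then N0 else N1)"

fun strand_from :: "ltype \<Rightarrow> point \<Rightarrow> point option" where
  "strand_from l (Minus_inf x) =
     (if l = A \<or> l = D then Some (At x) else if l = C0 \<or> l = C1 then Some (Plus_inf x) else None)"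
| "strand_from l (At x) =
     (if l = N1 \<or> l = C1 then Some (At x) else if l = B \<or> l = D then Some (Plus_inf x) else None)"
| "strand_from l (Plus_inf x) = None"

fun free_end :: "ltype \<Rightarrow> point \<Rightarrow> bool" where
  "free_end l (Minus_inf x) \<longleftrightarrow> l = N0 \<or> l = N1 \<or> l = B"
| "free_end l (At x) \<longleftrightarrow> False"
| "free_end l (Plus_inf x) \<longleftrightarrow> l = N0 \<or> l = N1 \<or> l = A"

text \<open>The inverse of taking local types and domain. The set \<open>S\<close> is consulted only
  at endpoints that the type leaves free, so any set is admissible; the empty set gives the
  prescribed strands without horizontals at the endpoints.\<close>

definition mk_strands :: "(place \<Rightarrow> ltype) \<Rightarrow> point set \<Rightarrow> strands" where
  "mk_strands ty S z =
    (if z \<in> S \<and> free_end (ty (interval z)) z then Some z else strand_from (ty (interval z)) z)"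

lemma all_point: "(\<forall>z. Q z) \<longleftrightarrow> (\<forall>x. Q (Minus_inf x) \<and> Q (At x) \<and> Q (Plus_inf x))"
  by (metis point.exhaust)

lemma le_point_simps [simp]:
  "Minus_inf x \<le> Minus_inf y \<longleftrightarrow> x = y" "Minus_inf x \<le> At y \<longleftrightarrow> x = y" "Minus_inf x \<le> Plus_inf y \<longleftrightarrow> x = y"
  "At x \<le> Minus_inf y \<longleftrightarrow> False" "At x \<le> At y \<longleftrightarrow> x = y" "At x \<le> Plus_inf y \<longleftrightarrow> x = y"
  "Plus_inf x \<le> Minus_inf y \<longleftrightarrow> False" "Plus_inf x \<le> At y \<longleftrightarrow> False" "Plus_inf x \<le> Plus_inf y \<longleftrightarrow> x = y"
  by (auto simp: less_eq_point_def)

lemma less_point_simps [simp]: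
  "Minus_inf x < Minus_inf y \<longleftrightarrow> False" "Minus_inf x < At y \<longleftrightarrow> x = y" "Minus_inf x < Plus_inf y \<longleftrightarrow> x = y"
  "At x < Minus_inf y \<longleftrightarrow> False" "At x < At y \<longleftrightarrow> False" "At x < Plus_inf y \<longleftrightarrow> x = y"
  "Plus_inf x < Minus_inf y \<longleftrightarrow> False" "Plus_inf x < At y \<longleftrightarrow> False" "Plus_inf x < Plus_inf y \<longleftrightarrow> False"
  by (auto simp: less_point_def)

lemma ge_Minus_inf: "Minus_inf x \<le> z \<Longrightarrow> z = Minus_inf x \<or> z = At x \<or> z = Plus_inf x"
  by (cases z) auto

lemma ge_At: "At x \<le> z \<Longrightarrow> z = At x \<or> z = Plus_inf x"
  by (cases z) auto

lemma ge_Plus_inf: "Plus_inf x \<le> z \<Longrightarrow> z = Plus_inf x"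
  by (cases z) auto

lemma le_Minus_inf: "z \<le> Minus_inf x \<Longrightarrow> z = Minus_inf x"
  by (cases z) auto

lemma le_At: "z \<le> At x \<Longrightarrow> z = Minus_inf x \<or> z = At x"
  by (cases z) auto

lemma le_Plus_inf: "z \<le> Plus_inf x \<Longrightarrow> z = Minus_inf x \<or> z = At x \<or> z = Plus_inf x"
  by (cases z) auto

lemma strand_diagram_cases:
  assumes "strand_diagram \<phi>"
  shows "\<phi> (Minus_inf x) \<in> {None, Some (Minus_inf x), Some (At x), Some (Plus_inf x)}"
    "\<phi> (At x) \<in> {None, Some (At x), Some (Plus_inf x)}"
    "\<phi> (Plus_inf x) \<in> {None, Some (Plus_inf x)}"
    "\<phi> (At x) = Some (At x) \<Longrightarrow> \<phi> (Minus_inf x) \<noteq> Some (At x)"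
    "\<phi> (At x) = Some (Plus_inf x) \<Longrightarrow> \<phi> (Minus_inf x) \<noteq> Some (Plus_inf x)"
    "\<phi> (Plus_inf x) = Some (Plus_inf x) \<Longrightarrow> \<phi> (Minus_inf x) \<noteq> Some (Plus_inf x)"
    "\<phi> (Plus_inf x) = Some (Plus_inf x) \<Longrightarrow> \<phi> (At x) \<noteq> Some (Plus_inf x)"
proof -
  have le: "z \<le> w" if "\<phi> z = Some w" for z w
    using assms that by (auto simp: strand_diagram_def)
  have inj: "z = z'" if "\<phi> z = Some w" "\<phi> z' = Some w" for z z' w
    using assms that by (auto simp: strand_diagram_def inj_on_def dom_def)
  show "\<phi> (Minus_inf x) \<in> {None, Some (Minus_inf x), Some (At x), Some (Plus_inf x)}"
    by (cases "\<phi> (Minus_inf x)") (auto dest!: le ge_Minus_inf)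
  show "\<phi> (At x) \<in> {None, Some (At x), Some (Plus_inf x)}"
    by (cases "\<phi> (At x)") (auto dest!: le ge_At)
  show "\<phi> (Plus_inf x) \<in> {None, Some (Plus_inf x)}"
    by (cases "\<phi> (Plus_inf x)") (auto dest!: le ge_Plus_inf)
  show "\<phi> (At x) = Some (At x) \<Longrightarrow> \<phi> (Minus_inf x) \<noteq> Some (At x)"
    "\<phi> (At x) = Some (Plus_inf x) \<Longrightarrow> \<phi> (Minus_inf x) \<noteq> Some (Plus_inf x)"
    "\<phi> (Plus_inf x) = Some (Plus_inf x) \<Longrightarrow> \<phi> (Minus_inf x) \<noteq> Some (Plus_inf x)"
    "\<phi> (Plus_inf x) = Some (Plus_inf x) \<Longrightarrow> \<phi> (At x) \<noteq> Some (Plus_inf x)"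
    using inj by blast+
qed

text \<open>Horizontal strands at free endpoints give four variants of \<open>N0\<close> and of
  \<open>N1\<close>, two of \<open>A\<close> and of \<open>B\<close>, and one of each remaining
  type. Later local claims are settled by running through these fifteen configurations.\<close>

lemma local_type_cases:
  assumes "strand_diagram \<phi>"
  shows "local_type \<phi> x = N0 \<and> \<phi> (Minus_inf x) = None \<and> \<phi> (At x) = None \<and> \<phi> (Plus_inf x) = None \<or>
     local_type \<phi> x = N0 \<and> \<phi> (Minus_inf x) = None \<and> \<phi> (At x) = None \<and> \<phi> (Plus_inf x) = Some (Plus_inf x) \<or>
     local_type \<phi> x = N0 \<and> \<phi> (Minus_inf x) = Some (Minus_inf x) \<and> \<phi> (At x) = None \<and> \<phi> (Plus_inf x) = None \<or>
     local_type \<phi> x = N0 \<and> \<phi> (Minus_inf x) = Some (Minus_inf x) \<and> \<phi> (At x) = None \<and> \<phi> (Plus_inf x) = Some (Plus_inf x) \<or>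
     local_type \<phi> x = N1 \<and> \<phi> (Minus_inf x) = None \<and> \<phi> (At x) = Some (At x) \<and> \<phi> (Plus_inf x) = None \<or>
     local_type \<phi> x = N1 \<and> \<phi> (Minus_inf x) = None \<and> \<phi> (At x) = Some (At x) \<and> \<phi> (Plus_inf x) = Some (Plus_inf x) \<or>
     local_type \<phi> x = N1 \<and> \<phi> (Minus_inf x) = Some (Minus_inf x) \<and> \<phi> (At x) = Some (At x) \<and> \<phi> (Plus_inf x) = None \<or>
     local_type \<phi> x = N1 \<and> \<phi> (Minus_inf x) = Some (Minus_inf x) \<and> \<phi> (At x) = Some (At x) \<and> \<phi> (Plus_inf x) = Some (Plus_inf x) \<or>
     local_type \<phi> x = A \<and> \<phi> (Minus_inf x) = Some (At x) \<and> \<phi> (At x) = None \<and> \<phi> (Plus_inf x) = None \<or>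
     local_type \<phi> x = A \<and> \<phi> (Minus_inf x) = Some (At x) \<and> \<phi> (At x) = None \<and> \<phi> (Plus_inf x) = Some (Plus_inf x) \<or>
     local_type \<phi> x = B \<and> \<phi> (Minus_inf x) = None \<and> \<phi> (At x) = Some (Plus_inf x) \<and> \<phi> (Plus_inf x) = None \<or>
     local_type \<phi> x = B \<and> \<phi> (Minus_inf x) = Some (Minus_inf x) \<and> \<phi> (At x) = Some (Plus_inf x) \<and> \<phi> (Plus_inf x) = None \<or>
     local_type \<phi> x = C0 \<and> \<phi> (Minus_inf x) = Some (Plus_inf x) \<and> \<phi> (At x) = None \<and> \<phi> (Plus_inf x) = None \<or>
     local_type \<phi> x = C1 \<and> \<phi> (Minus_inf x) = Some (Plus_inf x) \<and> \<phi> (At x) = Some (At x) \<and> \<phi> (Plus_inf x) = None \<or>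
     local_type \<phi> x = D \<and> \<phi> (Minus_inf x) = Some (At x) \<and> \<phi> (At x) = Some (Plus_inf x) \<and> \<phi> (Plus_inf x) = None"
  using strand_diagram_cases[OF assms, of x] unfolding local_type_def insert_iff empty_iff
  by (elim disjE; simp)

lemma mk_strands_local_type:
  assumes "strand_diagram \<phi>"
  shows "mk_strands (local_type \<phi>) (dom \<phi>) = \<phi>"
proof -
  have "mk_strands (local_type \<phi>) (dom \<phi>) (Minus_inf x) = \<phi> (Minus_inf x) \<and>
    mk_strands (local_type \<phi>) (dom \<phi>) (At x) = \<phi> (At x) \<and>
    mk_strands (local_type \<phi>) (dom \<phi>) (Plus_inf x) = \<phi> (Plus_inf x)" for x
    using local_type_cases[OF assms, of x]
    by (elim disjE; simp add: mk_strands_def dom_def)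
  then have "\<forall>z. mk_strands (local_type \<phi>) (dom \<phi>) z = \<phi> z"
    unfolding all_point by blast
  then show ?thesis by blast
qed

text \<open>The types fix all strands except the horizontals at the endpoints, and the domain fixes
  those.\<close>

lemma strand_diagram_eqI:
  assumes "strand_diagram \<phi>" "strand_diagram \<psi>" "local_type \<phi> = local_type \<psi>" "dom \<phi> = dom \<psi>"
  shows "\<phi> = \<psi>"
  using assms mk_strands_local_type by metis

lemma mk_strands_simps:
  "mk_strands ty S (Minus_inf x) = (case ty x of
     A \<Rightarrow> Some (At x) | D \<Rightarrow> Some (At x) | C0 \<Rightarrow> Some (Plus_inf x) | C1 \<Rightarrow> Some (Plus_inf x)
   | _ \<Rightarrow> if Minus_inf x \<in> S then Some (Minus_inf x) else None)"
  "mk_strands ty S (At x) = (case ty x of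
     N1 \<Rightarrow> Some (At x) | C1 \<Rightarrow> Some (At x) | B \<Rightarrow> Some (Plus_inf x) | D \<Rightarrow> Some (Plus_inf x)
   | _ \<Rightarrow> None)"
  "mk_strands ty S (Plus_inf x) = (if Plus_inf x \<in> S then (case ty x of
     N0 \<Rightarrow> Some (Plus_inf x) | N1 \<Rightarrow> Some (Plus_inf x) | A \<Rightarrow> Some (Plus_inf x)
   | _ \<Rightarrow> None) else None)"
  by (cases "ty x"; simp add: mk_strands_def)+

lemma strand_diagram_mk [simp]: "strand_diagram (mk_strands ty S)"
proof -
  have le: "z \<le> w" if "mk_strands ty S z = Some w" for z w
    using that by (cases z; cases "ty (interval z)"; simp add: mk_strands_simps split: if_splits; force)
  have inj: "z = z'" if z: "mk_strands ty S z = Some w" "mk_strands ty S z' = Some w" for z z' w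
  proof -
    have "interval z = interval z'"
      using le[OF z(1)] le[OF z(2)] by (simp add: less_eq_point_def)
    then show ?thesis
      using z by (cases z; cases z'; cases "ty (interval z)"; simp add: mk_strands_simps split: if_splits; force)
  qed
  show ?thesis
    unfolding strand_diagram_def inj_on_def using le inj by (metis domD)
qed

lemma local_type_mk [simp]: "local_type (mk_strands ty S) = ty"
proof
  fix x show "local_type (mk_strands ty S) x = ty x"
    by (cases "ty x"; simp add: local_type_def mk_strands_simps)
qed

fun src :: "ltype \<Rightarrow> bool" where
  "src l \<longleftrightarrow> l = N1 \<or> l = B \<or> l = C1 \<or> l = D"

fun tgt :: "ltype \<Rightarrow> bool" where
  "tgt l \<longleftrightarrow> l = N1 \<or> l = A \<or> l = C1 \<or> l = D"

lemma dom_local_type: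
  assumes "strand_diagram \<phi>"
  shows "At x \<in> dom \<phi> \<longleftrightarrow> src (local_type \<phi> x)"
  using local_type_cases[OF assms, of x] by (elim disjE; simp add: dom_def)

lemma ran_strand_diagram:
  assumes "strand_diagram \<phi>"
  shows "Minus_inf x \<in> ran \<phi> \<longleftrightarrow> \<phi> (Minus_inf x) = Some (Minus_inf x)"
    "At x \<in> ran \<phi> \<longleftrightarrow> \<phi> (Minus_inf x) = Some (At x) \<or> \<phi> (At x) = Some (At x)"
    "Plus_inf x \<in> ran \<phi> \<longleftrightarrow> \<phi> (Minus_inf x) = Some (Plus_inf x) \<or> \<phi> (At x) = Some (Plus_inf x)
       \<or> \<phi> (Plus_inf x) = Some (Plus_inf x)"
proof -
  have le: "z \<le> w" if "\<phi> z = Some w" for z w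
    using assms that by (auto simp: strand_diagram_def)
  show "Minus_inf x \<in> ran \<phi> \<longleftrightarrow> \<phi> (Minus_inf x) = Some (Minus_inf x)"
    "At x \<in> ran \<phi> \<longleftrightarrow> \<phi> (Minus_inf x) = Some (At x) \<or> \<phi> (At x) = Some (At x)"
    "Plus_inf x \<in> ran \<phi> \<longleftrightarrow> \<phi> (Minus_inf x) = Some (Plus_inf x) \<or> \<phi> (At x) = Some (Plus_inf x)
       \<or> \<phi> (Plus_inf x) = Some (Plus_inf x)"
    unfolding ran_def mem_Collect_eq
    using le by (metis le_Minus_inf, metis le_At, metis le_Plus_inf)
qed

lemma ran_local_type:
  assumes "strand_diagram \<phi>"
  shows "At x \<in> ran \<phi> \<longleftrightarrow> tgt (local_type \<phi> x)"
  using local_type_cases[OF assms, of x]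
  by (elim disjE; simp add: ran_strand_diagram[OF assms])

text \<open>No strand ends beyond the last point of an interval, and the two strands of
  \<open>D\<close> keep their order. Only a strand along the whole interval and a horizontal strand
  at the place are inverted.\<close>

lemma crossings_local_type:
  assumes "strand_diagram \<phi>"
  shows "crossings \<phi> = {(Minus_inf x, At x) | x. local_type \<phi> x = C1}"
proof -
  have "(z, w) \<in> crossings \<phi> \<longleftrightarrow> (\<exists>x. z = Minus_inf x \<and> w = At x \<and> local_type \<phi> x = C1)" for z w
  proof
    assume "(z, w) \<in> crossings \<phi>"
    then obtain z' w' where zw: "\<phi> z = Some z'" "\<phi> w = Some w'" "z < w" "w' < z'"
      by (auto simp: crossings_def)
    then consider x where "z = Minus_inf x" "w = At x" | x where "z = Minus_inf x" "w = Plus_inf x"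
      | x where "z = At x" "w = Plus_inf x"
      by (cases z; cases w) auto
    then show "\<exists>x. z = Minus_inf x \<and> w = At x \<and> local_type \<phi> x = C1"
    proof cases
      case (1 x) then show ?thesis using zw local_type_cases[OF assms, of x] by (elim disjE; auto)
    next
      case (2 x) then show ?thesis using zw local_type_cases[OF assms, of x] by (elim disjE; auto)
    next
      case (3 x) then show ?thesis using zw local_type_cases[OF assms, of x] by (elim disjE; auto)
    qed
  next
    assume "\<exists>x. z = Minus_inf x \<and> w = At x \<and> local_type \<phi> x = C1"
    then obtain x where x: "z = Minus_inf x" "w = At x" "local_type \<phi> x = C1" by blast
    then show "(z, w) \<in> crossings \<phi>"
      using local_type_cases[OF assms, of x] by (simp add: crossings_def)
  qed
  then show ?thesis by auto
qed

lemma inv_num_local_type: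
  assumes "strand_diagram \<phi>"
  shows "inv_num \<phi> = card {x. local_type \<phi> x = C1}"
proof -
  have "crossings \<phi> = (\<lambda>x. (Minus_inf x, At x)) ` {x. local_type \<phi> x = C1}"
    unfolding crossings_local_type[OF assms] by auto
  then show ?thesis
    unfolding inv_num_def by (simp add: card_image inj_on_def)
qed

section \<open>Composition of strand diagrams\<close>

fun ltype_mult :: "ltype \<Rightarrow> ltype \<Rightarrow> ltype option" where
  "ltype_mult N0 l = (if src l then None else Some l)"
| "ltype_mult N1 l = (if src l then Some l else None)"
| "ltype_mult A N1 = Some A"
| "ltype_mult A B = Some C0"
| "ltype_mult B N0 = Some B"
| "ltype_mult B A = Some D"
| "ltype_mult C0 N0 = Some C0"
| "ltype_mult C1 N1 = Some C1"
| "ltype_mult D N1 = Some D"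
| "ltype_mult _ _ = None"

lemma strand_diagram_comp:
  assumes "strand_diagram \<phi>" "strand_diagram \<psi>"
  shows "strand_diagram (\<psi> \<circ>\<^sub>m \<phi>)"
proof -
  have "z \<le> w" if "(\<psi> \<circ>\<^sub>m \<phi>) z = Some w" for z w
    using that assms unfolding strand_diagram_def map_comp_Some_iff by (meson order_trans)
  moreover have "z = z'" if "(\<psi> \<circ>\<^sub>m \<phi>) z = Some w" "(\<psi> \<circ>\<^sub>m \<phi>) z' = Some w" for z z' w
    using that assms unfolding strand_diagram_def map_comp_Some_iff inj_on_def by (metis domI)
  ultimately show ?thesis
    unfolding strand_diagram_def inj_on_def by (metis domD)
qed

text \<open>\<open>None\<close> in the table marks types whose range and domain cannot agree at the
  place or at an endpoint. When they agree everywhere, comparing the three points of the interval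
  leaves only the tabulated cases; for instance \<open>A\<close> followed by \<open>B\<close> joins
  into one long strand, while \<open>B\<close> followed by \<open>A\<close> leaves two
  strands.\<close>

lemma local_type_comp:
  assumes \<phi>: "strand_diagram \<phi>" and \<psi>: "strand_diagram \<psi>" and "ran \<phi> = dom \<psi>"
  shows "ltype_mult (local_type \<phi> x) (local_type \<psi> x) = Some (local_type (\<psi> \<circ>\<^sub>m \<phi>) x)"
proof -
  have "z \<in> ran \<phi> \<longleftrightarrow> \<psi> z \<noteq> None" for z using assms(3) by auto
  from this[of "Minus_inf x"] this[of "At x"] this[of "Plus_inf x"]
  have r: "\<phi> (Minus_inf x) = Some (Minus_inf x) \<longleftrightarrow> \<psi> (Minus_inf x) \<noteq> None"
    "\<phi> (Minus_inf x) = Some (At x) \<or> \<phi> (At x) = Some (At x) \<longleftrightarrow> \<psi> (At x) \<noteq> None"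
    "\<phi> (Minus_inf x) = Some (Plus_inf x) \<or> \<phi> (At x) = Some (Plus_inf x)
       \<or> \<phi> (Plus_inf x) = Some (Plus_inf x) \<longleftrightarrow> \<psi> (Plus_inf x) \<noteq> None"
    unfolding ran_strand_diagram[OF \<phi>] .
  have c: "(\<psi> \<circ>\<^sub>m \<phi>) z = (case \<phi> z of None \<Rightarrow> None | Some w \<Rightarrow> \<psi> w)" for z
    by (simp add: map_comp_def)
  show ?thesis
    using local_type_cases[OF \<phi>, of x]
    by (elim disjE; insert r local_type_cases[OF \<psi>, of x];
        simp; elim disjE; simp add: local_type_def[of "\<psi> \<circ>\<^sub>m \<phi>"] c)
qed

lemma ltype_mult_C1:
  "ltype_mult l l' = Some l'' \<Longrightarrow> l'' = C1 \<longleftrightarrow> l = C1 \<or> l' = C1"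
  "ltype_mult l l' = Some l'' \<Longrightarrow> \<not> (l = C1 \<and> l' = C1)"
  by (cases l; cases l'; auto)+

text \<open>Two strands of an interval cross at most once, so crossings never cancel in a composite.\<close>

lemma inv_num_comp:
  assumes "strand_diagram \<phi>" "strand_diagram \<psi>" "ran \<phi> = dom \<psi>"
  shows "inv_num (\<psi> \<circ>\<^sub>m \<phi>) = inv_num \<phi> + inv_num \<psi>"
proof -
  note c = local_type_comp[OF assms]
  have "{x. local_type (\<psi> \<circ>\<^sub>m \<phi>) x = C1} = {x. local_type \<phi> x = C1} \<union> {x. local_type \<psi> x = C1}"
    using ltype_mult_C1(1)[OF c] by auto
  moreover have "{x. local_type \<phi> x = C1} \<inter> {x. local_type \<psi> x = C1} = {}"
    using ltype_mult_C1(2)[OF c] by auto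
  ultimately show ?thesis
    by (simp add: inv_num_local_type strand_diagram_comp assms card_Un_disjoint)
qed

text \<open>Crossings add under composition, so the crossing condition in the product is automatic
  and only the matching of range and domain remains.\<close>

lemma strands_mult_strand_diagram:
  assumes "strand_diagram \<phi>" "strand_diagram \<psi>"
  shows "strands_mult \<phi> \<psi> = (if ran \<phi> = dom \<psi> then basis (\<psi> \<circ>\<^sub>m \<phi>) else 0)"
  using inv_num_comp[OF assms] by (auto simp: strands_mult_def)

lemma dom_comp: "ran \<phi> = dom \<psi> \<Longrightarrow> dom (\<psi> \<circ>\<^sub>m \<phi>) = dom \<phi>"
  by (force simp: dom_def ran_def map_comp_def split: option.splits)

lemma ran_comp: "ran \<phi> = dom \<psi> \<Longrightarrow> ran (\<psi> \<circ>\<^sub>m \<phi>) = ran \<psi>"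
  unfolding ran_def dom_def map_comp_Some_iff by blast

lemma mult_assoc_basis:
  assumes "strand_diagram \<phi>" "strand_diagram \<psi>" "strand_diagram \<xi>"
  shows "(basis \<phi> \<odot> basis \<psi>) \<odot> basis \<xi> = basis \<phi> \<odot> (basis \<psi> \<odot> basis \<xi>)"
proof -
  have "\<xi> \<circ>\<^sub>m (\<psi> \<circ>\<^sub>m \<phi>) = (\<xi> \<circ>\<^sub>m \<psi>) \<circ>\<^sub>m \<phi>"
    by (auto simp: map_comp_def split: option.splits)
  then show ?thesis
    using assms
    by (simp add: mult_basis strands_mult_strand_diagram strand_diagram_comp dom_comp ran_comp)
qed

text \<open>The type \<open>vec\<close> also admits arbitrary partial maps; associativity is derived
  for vectors supported on genuine strand diagrams, where products are plain compositions.\<close>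

definition strand_vec :: "vec \<Rightarrow> bool" where
  "strand_vec X \<longleftrightarrow> supp X \<subseteq> Collect strand_diagram"

lemma strand_vec_add: "strand_vec X \<Longrightarrow> strand_vec Y \<Longrightarrow> strand_vec (X + Y)"
  using supp_add[of X Y] by (auto simp: strand_vec_def)

lemma strand_vec_zero [simp]: "strand_vec 0"
  by (simp add: strand_vec_def supp_def)

lemma strand_vec_ind [simp]: "strand_vec (ind S) \<longleftrightarrow> S \<subseteq> Collect strand_diagram"
  by (simp add: strand_vec_def)

lemma strand_vec_basis [simp]: "strand_vec (basis \<phi>) \<longleftrightarrow> strand_diagram \<phi>"
  by (auto simp: strand_vec_def supp_def basis_def)

lemma strand_vec_induct [consumes 1, case_names zero add]:
  assumes "strand_vec X" "Q 0"
    and "\<And>\<phi> Y. strand_diagram \<phi> \<Longrightarrow> strand_vec Y \<Longrightarrow> Q Y \<Longrightarrow> Q (basis \<phi> + Y)"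
  shows "Q X"
  using vec_supp_induct[of X "Collect strand_diagram" Q] assms by (auto simp: strand_vec_def)

lemma strand_vec_mult:
  assumes "strand_vec X" "strand_vec Y"
  shows "strand_vec (X \<odot> Y)"
  using assms(1)
proof (induction rule: strand_vec_induct)
  case zero
  show ?case by (simp only: mult_zero_left mult_zero_right strand_vec_zero)
next
  case (add \<phi> X)
  have "strand_vec (basis \<phi> \<odot> Y)"
    using assms(2)
  proof (induction rule: strand_vec_induct)
    case zero
    show ?case by (simp only: mult_zero_left mult_zero_right strand_vec_zero)
  next
    case (add \<psi> Y)
    with \<open>strand_diagram \<phi>\<close> have "strand_vec (basis \<phi> \<odot> basis \<psi>)"
      by (simp add: mult_basis strands_mult_strand_diagram strand_diagram_comp)
    with add.IH show ?case by (simp add: mult_add_right strand_vec_add del: plus_fun_apply)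
  qed
  with add.IH show ?case by (simp add: mult_add_left strand_vec_add del: plus_fun_apply)
qed

lemma mult_assoc:
  assumes "strand_vec X" "strand_vec Y" "strand_vec Z"
  shows "(X \<odot> Y) \<odot> Z = X \<odot> (Y \<odot> Z)"
  using assms(1)
proof (induction rule: strand_vec_induct)
  case zero
  show ?case by (simp only: mult_zero_left mult_zero_right strand_vec_zero)
next
  case X: (add \<phi> X)
  have "(basis \<phi> \<odot> Y) \<odot> Z = basis \<phi> \<odot> (Y \<odot> Z)"
    using assms(2)
  proof (induction rule: strand_vec_induct)
    case zero
    show ?case by (simp only: mult_zero_left mult_zero_right strand_vec_zero)
  next
    case Y: (add \<psi> Y)
    have "(basis \<phi> \<odot> basis \<psi>) \<odot> Z = basis \<phi> \<odot> (basis \<psi> \<odot> Z)"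
      using assms(3)
    proof (induction rule: strand_vec_induct)
      case zero
      show ?case by (simp only: mult_zero_left mult_zero_right strand_vec_zero)
    next
      case (add \<xi> Z)
      then show ?case
        using mult_assoc_basis[of \<phi> \<psi> \<xi>] X.hyps Y.hyps by (simp add: mult_add_right del: plus_fun_apply)
    qed
    then show ?case using Y.IH by (simp add: mult_add_right mult_add_left del: plus_fun_apply)
  qed
  then show ?case using X.IH by (simp add: mult_add_left del: plus_fun_apply)
qed

definition with_types :: "(place \<Rightarrow> ltype) \<Rightarrow> strands set" where
  "with_types ty = {\<phi>. strand_diagram \<phi> \<and> local_type \<phi> = ty}"

text \<open>The first factor must start where the composite starts, and the second where the first
  ends. Together with the types this leaves one candidate for each, built by
  \<open>mk_strands\<close>.\<close>

lemma factor_strands: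
  assumes "strand_diagram \<chi>" "\<And>x. ltype_mult (ty x) (ty' x) = Some (local_type \<chi> x)"
  shows "\<exists>\<phi>\<in>with_types ty. \<exists>\<psi>\<in>with_types ty'. ran \<phi> = dom \<psi> \<and> \<psi> \<circ>\<^sub>m \<phi> = \<chi>"
proof -
  define \<phi> where "\<phi> = mk_strands ty (dom \<chi>)"
  define \<psi> where "\<psi> = mk_strands ty' (ran \<phi>)"
  have sd: "strand_diagram \<phi>" "strand_diagram \<psi>" by (simp_all add: \<phi>_def \<psi>_def)
  have types: "local_type \<phi> = ty" "local_type \<psi> = ty'" by (simp_all add: \<phi>_def \<psi>_def)
  have "(\<phi> (Minus_inf x) = None \<longleftrightarrow> \<chi> (Minus_inf x) = None) \<and>
    (\<phi> (At x) = None \<longleftrightarrow> \<chi> (At x) = None) \<and> (\<phi> (Plus_inf x) = None \<longleftrightarrow> \<chi> (Plus_inf x) = None)" for x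
    unfolding \<phi>_def mk_strands_simps
    using local_type_cases[OF assms(1), of x] assms(2)[of x]
    by (elim disjE; cases "ty x"; cases "ty' x"; simp add: dom_def split: if_splits)
  then have "\<forall>z. \<phi> z = None \<longleftrightarrow> \<chi> z = None" unfolding all_point by blast
  then have dom: "dom \<phi> = dom \<chi>" by (auto simp: dom_def)
  have "(Minus_inf x \<in> ran \<phi> \<longleftrightarrow> \<psi> (Minus_inf x) \<noteq> None) \<and>
    (At x \<in> ran \<phi> \<longleftrightarrow> \<psi> (At x) \<noteq> None) \<and> (Plus_inf x \<in> ran \<phi> \<longleftrightarrow> \<psi> (Plus_inf x) \<noteq> None)" for x
    unfolding \<psi>_def mk_strands_simps ran_strand_diagram[OF sd(1)]
    unfolding \<phi>_def mk_strands_simps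
    using local_type_cases[OF assms(1), of x] assms(2)[of x]
    by (elim disjE; cases "ty x"; cases "ty' x"; simp add: dom_def split: if_splits)
  then have "\<forall>z. z \<in> ran \<phi> \<longleftrightarrow> \<psi> z \<noteq> None" unfolding all_point by blast
  then have ran: "ran \<phi> = dom \<psi>" by (auto simp: dom_def)
  have "local_type (\<psi> \<circ>\<^sub>m \<phi>) x = local_type \<chi> x" for x
    using local_type_comp[OF sd ran, of x] assms(2)[of x] by (simp add: types)
  then have "\<psi> \<circ>\<^sub>m \<phi> = \<chi>"
    using sd assms(1) ran dom by (intro strand_diagram_eqI) (auto simp: strand_diagram_comp dom_comp)
  with sd types ran show ?thesis by (auto simp: with_types_def)
qed

definition T :: "(place \<Rightarrow> ltype) \<Rightarrow> vec" where
  "T ty = ind (with_types ty)"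

text \<open>Composition maps the matching pairs of the given types bijectively onto the diagrams of
  the product types, so nothing cancels over the two-element field. Injectivity holds because a
  composite has the domain of its first factor, whose range is in turn the domain of the
  second.\<close>

lemma mult_T:
  "T ty \<odot> T ty' =
    (if \<forall>x. ltype_mult (ty x) (ty' x) \<noteq> None then T (\<lambda>x. the (ltype_mult (ty x) (ty' x))) else 0)"
proof -
  define R where "R = {(\<phi>, \<psi>). \<phi> \<in> with_types ty \<and> \<psi> \<in> with_types ty' \<and> ran \<phi> = dom \<psi>}"
  define f :: "strands \<times> strands \<Rightarrow> strands" where "f = (\<lambda>(\<phi>, \<psi>). \<psi> \<circ>\<^sub>m \<phi>)"
  have "T ty \<odot> T ty' = (\<Sum>\<phi>\<in>with_types ty. \<Sum>\<psi>\<in>with_types ty'. strands_mult \<phi> \<psi>)"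
    by (simp add: T_def mult_def)
  also have "\<dots> = (\<Sum>(\<phi>, \<psi>)\<in>with_types ty \<times> with_types ty'. strands_mult \<phi> \<psi>)"
    by (simp add: sum.cartesian_product)
  also have "\<dots> = (\<Sum>a\<in>R. basis (f a))"
  proof (rule sum.mono_neutral_cong_right)
    show "\<forall>a\<in>with_types ty \<times> with_types ty' - R. (case a of (\<phi>, \<psi>) \<Rightarrow> strands_mult \<phi> \<psi>) = 0"
    proof (intro ballI, clarify)
      fix \<phi> \<psi> assume "(\<phi>, \<psi>) \<notin> R" "\<phi> \<in> with_types ty" "\<psi> \<in> with_types ty'"
      then have "ran \<phi> \<noteq> dom \<psi>" "strand_diagram \<phi>" "strand_diagram \<psi>"
        by (simp_all add: R_def with_types_def)
      then show "strands_mult \<phi> \<psi> = 0" by (simp add: strands_mult_strand_diagram)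
    qed
  qed (auto simp: R_def f_def with_types_def strands_mult_strand_diagram)
  also have "\<dots> = ind (f ` R)"
  proof (rule sum_basis_image)
    show "inj_on f R"
    proof (rule inj_onI, clarify)
      fix \<phi> \<psi> \<phi>' \<psi>'
      assume R: "(\<phi>, \<psi>) \<in> R" "(\<phi>', \<psi>') \<in> R" and f: "f (\<phi>, \<psi>) = f (\<phi>', \<psi>')"
      then have "dom \<phi> = dom \<phi>'"
        by (auto simp: R_def f_def dest!: dom_comp) (metis domI domD)+
      with R have "\<phi> = \<phi>'" by (intro strand_diagram_eqI) (auto simp: R_def with_types_def)
      moreover from this R have "\<psi> = \<psi>'" by (intro strand_diagram_eqI) (auto simp: R_def with_types_def)
      ultimately show "\<phi> = \<phi>' \<and> \<psi> = \<psi>'" by blast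
    qed
  qed
  finally have prod: "T ty \<odot> T ty' = ind (f ` R)" .
  have comp: "ltype_mult (ty x) (ty' x) = Some (local_type \<chi> x) \<and> strand_diagram \<chi>"
    if "\<chi> \<in> f ` R" for \<chi> x
    using that by (auto simp: R_def f_def with_types_def local_type_comp strand_diagram_comp)
  show ?thesis
  proof (cases "\<forall>x. ltype_mult (ty x) (ty' x) \<noteq> None")
    case True
    have "f ` R = with_types (\<lambda>x. the (ltype_mult (ty x) (ty' x)))"
    proof (intro equalityI subsetI)
      fix \<chi> assume "\<chi> \<in> f ` R"
      from comp[OF this] show "\<chi> \<in> with_types (\<lambda>x. the (ltype_mult (ty x) (ty' x)))"
        by (auto simp: with_types_def)
    next
      fix \<chi> assume "\<chi> \<in> with_types (\<lambda>x. the (ltype_mult (ty x) (ty' x)))"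
      then have "strand_diagram \<chi>" "\<And>x. ltype_mult (ty x) (ty' x) = Some (local_type \<chi> x)"
        using True by (auto simp: with_types_def)
      from factor_strands[OF this] show "\<chi> \<in> f ` R"
        by (force simp: R_def f_def)
    qed
    with True prod show ?thesis by (simp add: T_def)
  next
    case False
    with comp have "f ` R = {}" by fastforce
    with prod have "T ty \<odot> T ty' = ind {}" by simp
    also have "\<dots> = 0" by (simp add: ind_def fun_eq_iff)
    finally show ?thesis using False by metis
  qed
qed

section \<open>The differential on sums of given types\<close>

lemma strands_diff_no_crossing:
  assumes "strand_diagram \<phi>" "\<And>x. local_type \<phi> x \<noteq> C1"
  shows "strands_diff \<phi> = 0"
proof -
  have "crossings \<phi> = {}" by (simp add: crossings_local_type assms)
  then show ?thesis by (simp add: strands_diff_def)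
qed

lemma diff_T_no_crossing:
  assumes "\<And>x. ty x \<noteq> C1"
  shows "\<partial> (T ty) = 0"
  unfolding T_def diff_lin lin_ind
  by (intro sum.neutral) (auto simp: with_types_def strands_diff_no_crossing assms)

lemma resolve_mk:
  assumes "ty x = C1"
  shows "resolve (mk_strands ty S) (Minus_inf x) (At x) = mk_strands (ty(x := D)) S"
proof -
  have "\<forall>z. resolve (mk_strands ty S) (Minus_inf x) (At x) z = mk_strands (ty(x := D)) S z"
    unfolding all_point using assms by (auto simp: resolve_def mk_strands_simps split: ltype.split)
  then show ?thesis by blast
qed

lemma strands_diff_one_crossing:
  assumes "strand_diagram \<phi>" "local_type \<phi> x = C1" "\<And>y. y \<noteq> x \<Longrightarrow> local_type \<phi> y \<noteq> C1"
  shows "strands_diff \<phi> = basis (resolve \<phi> (Minus_inf x) (At x))"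
proof -
  have "{y. local_type \<phi> y = C1} = {x}" using assms by auto
  then have "crossings \<phi> = {(Minus_inf x, At x)}" "inv_num \<phi> = 1"
    by (auto simp: crossings_local_type inv_num_local_type assms)
  moreover have "resolve \<phi> (Minus_inf x) (At x) = mk_strands ((local_type \<phi>)(x := D)) (dom \<phi>)"
    using resolve_mk[of "local_type \<phi>" x "dom \<phi>"] assms by (simp add: mk_strands_local_type)
  then have "inv_num (resolve \<phi> (Minus_inf x) (At x)) = 0"
    using assms(3) by (simp add: inv_num_local_type)
  ultimately have "{(y, z). (y, z) \<in> crossings \<phi> \<and> inv_num (resolve \<phi> y z) + 1 = inv_num \<phi>}
      = {(Minus_inf x, At x)}" by auto
  then show ?thesis by (simp add: strands_diff_def)
qed

text \<open>Resolving the crossing turns \<open>C1\<close> into \<open>D\<close> on one interval and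
  is a bijection between the two classes of strand diagrams. One crossing is enough: two intervals
  of type \<open>C1\<close> would occupy both places of the pair, which no idempotent
  admits.\<close>

lemma diff_T_one_crossing:
  assumes "ty x = C1" "\<And>y. y \<noteq> x \<Longrightarrow> ty y \<noteq> C1"
  shows "\<partial> (T ty) = T (ty(x := D))"
proof -
  let ?r = "\<lambda>\<phi>. resolve \<phi> (Minus_inf x) (At x)"
  have "\<partial> (T ty) = (\<Sum>\<phi>\<in>with_types ty. basis (?r \<phi>))"
    unfolding T_def diff_lin lin_ind
    using assms by (intro sum.cong refl strands_diff_one_crossing) (auto simp: with_types_def)
  also have "\<dots> = ind (?r ` with_types ty)"
  \<comment> \<open>Resolving exchanges two values of the map, so it is its own inverse.\<close>
  proof (intro sum_basis_image inj_on_inverseI[of _ ?r])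
    fix \<phi> show "?r (?r \<phi>) = \<phi>" by (auto simp: resolve_def)
  qed
  also have "?r ` with_types ty = with_types (ty(x := D))"
  proof (intro equalityI subsetI)
    fix \<chi> assume "\<chi> \<in> ?r ` with_types ty"
    then obtain \<phi> where \<phi>: "strand_diagram \<phi>" "local_type \<phi> = ty" "\<chi> = ?r \<phi>"
      by (auto simp: with_types_def)
    then have "\<chi> = mk_strands (ty(x := D)) (dom \<phi>)"
      using resolve_mk[of ty x "dom \<phi>"] mk_strands_local_type[of \<phi>] assms by simp
    then show "\<chi> \<in> with_types (ty(x := D))" by (simp add: with_types_def)
  next
    fix \<chi> assume "\<chi> \<in> with_types (ty(x := D))"
    then have "\<chi> = mk_strands (ty(x := D)) (dom \<chi>)"
      using mk_strands_local_type[of \<chi>] by (auto simp: with_types_def)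
    also have "\<dots> = ?r (mk_strands ty (dom \<chi>))" using assms by (simp add: resolve_mk)
    finally show "\<chi> \<in> ?r ` with_types ty"
      using image_eqI[of \<chi> ?r "mk_strands ty (dom \<chi>)" "with_types ty"] by (simp add: with_types_def)
  qed
  finally show ?thesis by (simp add: T_def)
qed

section \<open>Idempotents and horizontal strands\<close>

lemma strand_diagram_id [simp]: "strand_diagram (id_strands U)"
  by (auto simp: strand_diagram_def id_strands_def inj_on_def restrict_map_def split: if_splits)

lemma dom_id_strands [simp]: "dom (id_strands U) = U"
  by (auto simp: id_strands_def restrict_map_def dom_def)

lemma ran_id_strands [simp]: "ran (id_strands U) = U"
  by (auto simp: id_strands_def restrict_map_def ran_def)

lemma id_strands_comp:
  "\<phi> \<circ>\<^sub>m id_strands (dom \<phi>) = \<phi>" "id_strands (ran \<phi>) \<circ>\<^sub>m \<phi> = \<phi>"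
  by (rule ext; auto simp: id_strands_def map_comp_def restrict_map_def dom_def ran_def split: option.splits)+

lemma strands_mult_id:
  assumes "strand_diagram \<phi>"
  shows "strands_mult (id_strands S) \<phi> = (if S = dom \<phi> then basis \<phi> else 0)"
    and "strands_mult \<phi> (id_strands S) = (if S = ran \<phi> then basis \<phi> else 0)"
  using assms by (simp_all add: strands_mult_strand_diagram id_strands_comp eq_commute[of "ran \<phi>"])

definition idem_count :: "idem \<Rightarrow> nat" where
  "idem_count s = (if P \<in> s then 1 else 0)"

lemma idempotent_ind:
  "idempotent s = ind (id_strands ` {S. card (S \<inter> P) = idem_count s})"
  unfolding idempotent_def idem_count_def
  by (rule sum_basis_image) (metis (lifting) inj_onI dom_id_strands)

text \<open>Of all the identity diagrams in the idempotent, only the one on the domain of a given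
  strand diagram composes with it; so multiplication filters by the number of occupied
  places.\<close>

lemma idempotent_mult_left:
  assumes "X \<subseteq> Collect strand_diagram"
  shows "idempotent s \<odot> ind X = ind {\<phi> \<in> X. card (dom \<phi> \<inter> P) = idem_count s}"
proof -
  let ?I = "{S. card (S \<inter> P) = idem_count s}"
  have inj: "inj_on id_strands ?I" by (metis (lifting) inj_onI dom_id_strands)
  have "idempotent s \<odot> ind X = (\<Sum>S\<in>?I. \<Sum>\<phi>\<in>X. strands_mult (id_strands S) \<phi>)"
    unfolding mult_def idempotent_ind supp_ind sum.reindex[OF inj] by simp
  also have "\<dots> = (\<Sum>\<phi>\<in>X. \<Sum>S\<in>?I. strands_mult (id_strands S) \<phi>)"
    by (rule sum.swap)
  also have "\<dots> = (\<Sum>\<phi>\<in>X. \<Sum>S\<in>?I. if S = dom \<phi> then basis \<phi> else 0)"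
    using assms by (intro sum.cong refl) (auto simp only: strands_mult_id mem_Collect_eq dest!: subsetD)
  also have "\<dots> = (\<Sum>\<phi>\<in>X. if card (dom \<phi> \<inter> P) = idem_count s then basis \<phi> else 0)"
    by (intro sum.cong refl) simp
  also have "\<dots> = ind {\<phi> \<in> X. card (dom \<phi> \<inter> P) = idem_count s}"
    unfolding ind_eq_sum by (rule sum.inter_filter [symmetric]) simp
  finally show ?thesis .
qed

lemma idempotent_mult_right:
  assumes "X \<subseteq> Collect strand_diagram"
  shows "ind X \<odot> idempotent t = ind {\<phi> \<in> X. card (ran \<phi> \<inter> P) = idem_count t}"
proof -
  let ?I = "{S. card (S \<inter> P) = idem_count t}"
  have inj: "inj_on id_strands ?I" by (metis (lifting) inj_onI dom_id_strands)
  have "ind X \<odot> idempotent t = (\<Sum>\<phi>\<in>X. \<Sum>S\<in>?I. strands_mult \<phi> (id_strands S))"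
    unfolding mult_def idempotent_ind supp_ind sum.reindex[OF inj] by simp
  also have "\<dots> = (\<Sum>\<phi>\<in>X. \<Sum>S\<in>?I. if S = ran \<phi> then basis \<phi> else 0)"
    using assms by (intro sum.cong refl) (auto simp only: strands_mult_id mem_Collect_eq dest!: subsetD)
  also have "\<dots> = (\<Sum>\<phi>\<in>X. if card (ran \<phi> \<inter> P) = idem_count t then basis \<phi> else 0)"
    by (intro sum.cong refl) simp
  also have "\<dots> = ind {\<phi> \<in> X. card (ran \<phi> \<inter> P) = idem_count t}"
    unfolding ind_eq_sum by (rule sum.inter_filter [symmetric]) simp
  finally show ?thesis .
qed

lemma add_horizontals_ind:
  "add_horizontals \<mu> = ind ((\<lambda>U. \<mu> ++ id_strands U) ` Pow (- (dom \<mu> \<union> ran \<mu>)))"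
  unfolding add_horizontals_def
proof (rule sum_basis_image, rule inj_on_inverseI)
  fix U assume "U \<in> Pow (- (dom \<mu> \<union> ran \<mu>))"
  then show "dom (\<mu> ++ id_strands U) - dom \<mu> = U" by (auto simp: dom_map_add)
qed

fun core :: "ltype \<Rightarrow> ltype" where
  "core N1 = N0" | "core C1 = C0" | "core l = l"

lemma horizontals_add:
  assumes "strand_diagram \<mu>" "\<And>z. \<mu> z \<noteq> Some z" "U \<subseteq> - (dom \<mu> \<union> ran \<mu>)"
  shows "strand_diagram (\<mu> ++ id_strands U)"
    and "core (local_type (\<mu> ++ id_strands U) x) = local_type \<mu> x"
proof -
  have val: "(\<mu> ++ id_strands U) z = (if z \<in> U then Some z else \<mu> z)" for z
    by (auto simp: map_add_def id_strands_def restrict_map_def)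
  have notin: "\<mu> z = None" "\<mu> w \<noteq> Some z" if "z \<in> U" for z w
    using assms(3) that by (auto simp: ran_def)
  show "strand_diagram (\<mu> ++ id_strands U)"
    unfolding strand_diagram_def
  proof (intro conjI allI impI)
    show "inj_on (\<mu> ++ id_strands U) (dom (\<mu> ++ id_strands U))"
    proof (rule inj_onI)
      fix z w assume z: "z \<in> dom (\<mu> ++ id_strands U)" "(\<mu> ++ id_strands U) z = (\<mu> ++ id_strands U) w"
      obtain y where "(\<mu> ++ id_strands U) z = Some y" using domD[OF z(1)] by (elim exE)
      with z(2) have "(if z \<in> U then Some z else \<mu> z) = Some y" "(if w \<in> U then Some w else \<mu> w) = Some y"
        by (simp_all only: val)
      with assms(1) notin show "z = w"
        by (auto simp: strand_diagram_def inj_on_def dom_def split: if_splits)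
    qed
  next
    fix z w assume "(\<mu> ++ id_strands U) z = Some w"
    then show "z \<le> w" using assms(1) by (auto simp: val strand_diagram_def split: if_splits)
  qed
  have "Minus_inf x \<notin> U \<or> \<mu> (Minus_inf x) = None" "At x \<notin> U \<or> \<mu> (At x) = None \<and> \<mu> (Minus_inf x) \<noteq> Some (At x)"
    "Plus_inf x \<notin> U \<or> \<mu> (Plus_inf x) = None \<and> \<mu> (Minus_inf x) \<noteq> Some (Plus_inf x) \<and> \<mu> (At x) \<noteq> Some (Plus_inf x)"
    using notin by metis+
  then show "core (local_type (\<mu> ++ id_strands U) x) = local_type \<mu> x"
    using local_type_cases[OF assms(1), of x] assms(2)
    unfolding local_type_def[of "\<mu> ++ id_strands U"] val
    by (elim disjE; simp)
qed

lemma local_type_cases_no_fixed: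
  assumes "strand_diagram \<mu>" "\<And>z. \<mu> z \<noteq> Some z"
  shows "local_type \<mu> x = N0 \<and> \<mu> (Minus_inf x) = None \<and> \<mu> (At x) = None \<and> \<mu> (Plus_inf x) = None \<or>
    local_type \<mu> x = A \<and> \<mu> (Minus_inf x) = Some (At x) \<and> \<mu> (At x) = None \<and> \<mu> (Plus_inf x) = None \<or>
    local_type \<mu> x = B \<and> \<mu> (Minus_inf x) = None \<and> \<mu> (At x) = Some (Plus_inf x) \<and> \<mu> (Plus_inf x) = None \<or>
    local_type \<mu> x = C0 \<and> \<mu> (Minus_inf x) = Some (Plus_inf x) \<and> \<mu> (At x) = None \<and> \<mu> (Plus_inf x) = None \<or>
    local_type \<mu> x = D \<and> \<mu> (Minus_inf x) = Some (At x) \<and> \<mu> (At x) = Some (Plus_inf x) \<and> \<mu> (Plus_inf x) = None"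
  using local_type_cases[OF assms(1), of x] assms(2)[of "Minus_inf x"] assms(2)[of "At x"] assms(2)[of "Plus_inf x"]
  by (elim disjE; simp)

lemma horizontals_decomp:
  assumes "strand_diagram \<mu>" "\<And>z. \<mu> z \<noteq> Some z"
    and "strand_diagram \<phi>" "\<And>x. core (local_type \<phi> x) = local_type \<mu> x"
  shows "\<exists>U \<subseteq> - (dom \<mu> \<union> ran \<mu>). \<phi> = \<mu> ++ id_strands U"
proof (intro exI conjI)
  \<comment> \<open>As \<mu> has no fixed points, the added horizontals must be exactly the fixed
    points of \<phi>.\<close>
  define U where "U = {z. \<phi> z = Some z}"
  have *: "(\<phi> (Minus_inf x) = (if Minus_inf x \<in> U then Some (Minus_inf x) else \<mu> (Minus_inf x)) \<and>
      (Minus_inf x \<in> U \<longrightarrow> Minus_inf x \<notin> dom \<mu> \<and> Minus_inf x \<notin> ran \<mu>)) \<and>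
    (\<phi> (At x) = (if At x \<in> U then Some (At x) else \<mu> (At x)) \<and>
      (At x \<in> U \<longrightarrow> At x \<notin> dom \<mu> \<and> At x \<notin> ran \<mu>)) \<and>
    (\<phi> (Plus_inf x) = (if Plus_inf x \<in> U then Some (Plus_inf x) else \<mu> (Plus_inf x)) \<and>
      (Plus_inf x \<in> U \<longrightarrow> Plus_inf x \<notin> dom \<mu> \<and> Plus_inf x \<notin> ran \<mu>))" for x
    unfolding ran_strand_diagram[OF assms(1)] U_def dom_def mem_Collect_eq
    using local_type_cases_no_fixed[OF assms(1,2), of x] local_type_cases[OF assms(3), of x] assms(4)[of x]
    by (elim disjE; simp)
  have "\<forall>z. \<phi> z = (if z \<in> U then Some z else \<mu> z) \<and> (z \<in> U \<longrightarrow> z \<notin> dom \<mu> \<and> z \<notin> ran \<mu>)"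
    unfolding all_point using * by blast
  then show "\<phi> = \<mu> ++ id_strands U" "U \<subseteq> - (dom \<mu> \<union> ran \<mu>)"
    by (auto simp: fun_eq_iff map_add_def id_strands_def restrict_map_def)
qed

instance ltype :: finite
proof
  have "UNIV = {N0, N1, A, B, C0, C1, D}" by (auto intro: ltype.exhaust)
  then show "finite (UNIV :: ltype set)" by (metis finite.emptyI finite.insertI)
qed

definition V :: "(place \<Rightarrow> ltype) set \<Rightarrow> vec" where
  "V Z = (\<Sum>ty\<in>Z. T ty)"

lemma V_ind: "V Z = ind {\<phi>. strand_diagram \<phi> \<and> local_type \<phi> \<in> Z}"
proof -
  have "V Z = (\<Sum>ty\<in>Z. \<Sum>\<phi>\<in>with_types ty. basis \<phi>)"
    by (simp add: V_def T_def ind_eq_sum)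
  also have "\<dots> = sum basis (\<Union>ty\<in>Z. with_types ty)"
    by (rule sum.UNION_disjoint [symmetric]) (auto simp: with_types_def)
  also have "(\<Union>ty\<in>Z. with_types ty) = {\<phi>. strand_diagram \<phi> \<and> local_type \<phi> \<in> Z}"
    by (auto simp: with_types_def)
  finally show ?thesis by (simp add: ind_eq_sum)
qed

text \<open>Here \<open>c\<close> gives the types of the moving strands, while \<open>m\<close> and
  \<open>n\<close> are the numbers of places of the pair occupied at the start and at the
  end.\<close>

definition diag_types :: "nat \<Rightarrow> (place \<Rightarrow> ltype) \<Rightarrow> nat \<Rightarrow> (place \<Rightarrow> ltype) set" where
  "diag_types m c n = {ty. (\<forall>x. core (ty x) = c x) \<and> card {x. src (ty x)} = m \<and> card {x. tgt (ty x)} = n}"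

lemma card_Int_P: "card (S \<inter> P) = card {x. At x \<in> S}"
proof -
  have "S \<inter> P = At ` {x. At x \<in> S}"
    using place.exhaust by (auto simp: P_def image_iff)
  then show ?thesis by (simp add: card_image inj_on_def)
qed

text \<open>Horizontals at the endpoints leave the types unchanged, and a horizontal at a place
  changes only what \<open>core\<close> forgets. Hence a diagram contains every strand diagram of
  each type that it meets, and is a sum of full type sums.\<close>

lemma diag_V:
  assumes "strand_diagram \<mu>" "\<And>z. \<mu> z \<noteq> Some z"
  shows "diag s \<mu> t = V (diag_types (idem_count s) (local_type \<mu>) (idem_count t))"
proof -
  let ?H = "{\<phi>. strand_diagram \<phi> \<and> (\<forall>x. core (local_type \<phi> x) = local_type \<mu> x)}"
  have "(\<lambda>U. \<mu> ++ id_strands U) ` Pow (- (dom \<mu> \<union> ran \<mu>)) = ?H"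
  proof (intro equalityI subsetI)
    fix \<phi> assume "\<phi> \<in> ?H"
    then show "\<phi> \<in> (\<lambda>U. \<mu> ++ id_strands U) ` Pow (- (dom \<mu> \<union> ran \<mu>))"
      using horizontals_decomp[OF assms, of \<phi>] by blast
  qed (use horizontals_add[OF assms] in auto)
  then have "diag s \<mu> t = idempotent s \<odot> ind ?H \<odot> idempotent t"
    by (simp add: diag_def add_horizontals_ind)
  also have "\<dots> = ind {\<phi> \<in> {\<phi> \<in> ?H. card (dom \<phi> \<inter> P) = idem_count s}. card (ran \<phi> \<inter> P) = idem_count t}"
    by (subst idempotent_mult_left, force, subst idempotent_mult_right) auto
  also have "\<dots> = V (diag_types (idem_count s) (local_type \<mu>) (idem_count t))"
    unfolding V_ind by (rule arg_cong[of _ _ ind])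
      (auto simp: diag_types_def card_Int_P dom_local_type ran_local_type simp del: src.simps tgt.simps)
  finally show ?thesis .
qed

section \<open>The diagrams\<close>

definition pr :: "ltype \<Rightarrow> ltype \<Rightarrow> place \<Rightarrow> ltype" where
  "pr a b x = (if x = p then a else b)"

lemma pr_simps [simp]: "pr a b p = a" "pr a b q = b"
  by (simp_all add: pr_def)

lemma pr_eta: "ty = pr (ty p) (ty q)"
proof
  fix x show "ty x = pr (ty p) (ty q) x" by (cases x) simp_all
qed

lemma pr_eq_iff [simp]: "pr a b = pr c d \<longleftrightarrow> a = c \<and> b = d"
  by (metis pr_simps)

definition TT :: "ltype \<Rightarrow> ltype \<Rightarrow> vec" where
  "TT a b = T (pr a b)"

lemma mult_TT:
  "TT a b \<odot> TT c d = (case ltype_mult a c of None \<Rightarrow> 0 | Some e \<Rightarrow>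
     (case ltype_mult b d of None \<Rightarrow> 0 | Some f \<Rightarrow> TT e f))"
proof -
  have "(\<lambda>x. the (ltype_mult (pr a b x) (pr c d x))) = pr (the (ltype_mult a c)) (the (ltype_mult b d))"
    by (simp add: fun_eq_iff all_place)
  then show ?thesis
    by (simp add: TT_def mult_T all_place split: option.splits)
qed

lemma strand_vec_TT [simp]: "strand_vec (TT a b)"
  by (auto simp: TT_def T_def with_types_def)

text \<open>The strand diagram of the given types without endpoint horizontals stands for its whole
  type class; evaluation there gives coordinates on the span of the vectors
  \<open>TT\<close>.\<close>

definition coeff :: "vec \<Rightarrow> ltype \<Rightarrow> ltype \<Rightarrow> bit" where
  "coeff X a b = X (mk_strands (pr a b) {})"

lemma coeff_TT [simp]: "coeff (TT a b) c d = (if a = c \<and> b = d then 1 else 0)"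
  by (auto simp: coeff_def TT_def T_def with_types_def ind_def)

lemma coeff_add [simp]: "coeff (X + Y) a b = coeff X a b + coeff Y a b"
  by (simp add: coeff_def)

lemma coeff_zero [simp]: "coeff 0 a b = 0"
  by (simp add: coeff_def)

lemma diff_TT:
  "a \<noteq> C1 \<Longrightarrow> b \<noteq> C1 \<Longrightarrow> \<partial> (TT a b) = 0"
  "b \<noteq> C1 \<Longrightarrow> \<partial> (TT C1 b) = TT D b"
  "a \<noteq> C1 \<Longrightarrow> \<partial> (TT a C1) = TT a D"
proof -
  have upd: "(pr C1 b)(p := D) = pr D b" "(pr a C1)(q := D) = pr a D"
    by (simp_all add: fun_eq_iff all_place)
  show "a \<noteq> C1 \<Longrightarrow> b \<noteq> C1 \<Longrightarrow> \<partial> (TT a b) = 0"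
    unfolding TT_def by (rule diff_T_no_crossing) (simp add: pr_def)
  show "b \<noteq> C1 \<Longrightarrow> \<partial> (TT C1 b) = TT D b"
    unfolding TT_def upd(1) [symmetric] by (rule diff_T_one_crossing) (auto simp: pr_def)
  show "a \<noteq> C1 \<Longrightarrow> \<partial> (TT a C1) = TT a D"
    unfolding TT_def upd(2) [symmetric] by (rule diff_T_one_crossing) (auto simp: pr_def split: if_splits intro: place.exhaust)
qed

lemma card_places: "card {x. Q x} = of_bool (Q p) + of_bool (Q q)"
proof -
  have "{x. Q x} = (if Q p then {p} else {}) \<union> (if Q q then {q} else {})"
  proof (rule set_eqI)
    fix x show "x \<in> {x. Q x} \<longleftrightarrow> x \<in> (if Q p then {p} else {}) \<union> (if Q q then {q} else {})"
      by (cases x) auto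
  qed
  then show ?thesis by simp
qed

definition balanced :: "nat \<Rightarrow> ltype \<Rightarrow> ltype \<Rightarrow> nat \<Rightarrow> bool" where
  "balanced m c d n \<longleftrightarrow>
    of_bool (src c) + of_bool (src d) = m \<and> of_bool (tgt c) + of_bool (tgt d) = n"

lemma V_diag_types:
  "V (diag_types m (pr a b) n) =
    (\<Sum>c | core c = a. \<Sum>d | core d = b. if balanced m c d n then TT c d else 0)" (is "_ = ?R")
proof -
  let ?K = "{c. core c = a} \<times> {d. core d = b}"
  let ?J = "{cd \<in> ?K. balanced m (fst cd) (snd cd) n}"
  have mem: "ty \<in> diag_types m (pr a b) n \<longleftrightarrow>
      core (ty p) = a \<and> core (ty q) = b \<and> balanced m (ty p) (ty q) n" for ty
    unfolding diag_types_def mem_Collect_eq card_places all_place pr_simps balanced_def by blast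
  have "diag_types m (pr a b) n = (\<lambda>cd. pr (fst cd) (snd cd)) ` ?J"
  proof (intro equalityI subsetI)
    fix ty assume "ty \<in> diag_types m (pr a b) n"
    then have "(ty p, ty q) \<in> ?J" by (simp add: mem)
    moreover have "ty = pr (fst (ty p, ty q)) (snd (ty p, ty q))" using pr_eta[of ty] by simp
    ultimately show "ty \<in> (\<lambda>cd. pr (fst cd) (snd cd)) ` ?J"
      by (rule rev_image_eqI)
  qed (auto simp: mem)
  moreover have "inj_on (\<lambda>cd. pr (fst cd) (snd cd)) ?J"
    by (auto simp: inj_on_def)
  ultimately have "V (diag_types m (pr a b) n) = (\<Sum>cd \<in> ?J. TT (fst cd) (snd cd))"
    unfolding V_def by (simp only: sum.reindex TT_def o_def)
  also have "\<dots> = (\<Sum>cd \<in> ?K. if balanced m (fst cd) (snd cd) n then TT (fst cd) (snd cd) else 0)"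
    by (rule sum.inter_filter) simp
  also have "\<dots> = ?R"
    by (simp add: sum.cartesian_product case_prod_beta)
  finally show ?thesis .
qed

lemma balanced_of_bool:
  "balanced (of_bool i) c d (of_bool j) \<longleftrightarrow>
    (if i then src c \<noteq> src d else \<not> src c \<and> \<not> src d) \<and>
    (if j then tgt c \<noteq> tgt d else \<not> tgt c \<and> \<not> tgt d)"
  by (auto simp: balanced_def simp del: src.simps tgt.simps)

lemma core_fibres:
  "{c. core c = N0} = {N0, N1}" "{c. core c = A} = {A}" "{c. core c = B} = {B}"
  "{c. core c = C0} = {C0, C1}" "{c. core c = D} = {D}" "{c. core c = N1} = {}" "{c. core c = C1} = {}"
  by (auto elim: core.elims)

section \<open>Covered steps and the list of diagrams\<close>

lemma homology_cover_local_type: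
  assumes "strand_diagram \<mu>" "\<And>z. \<mu> z \<noteq> Some z"
  shows "homology_cover \<mu> (Before x) = of_bool (local_type \<mu> x \<in> {A, C0, D})"
    and "homology_cover \<mu> (After x) = of_bool (local_type \<mu> x \<in> {B, C0, D})"
proof -
  note c = local_type_cases_no_fixed[OF assms, of x]
  have "z \<le> Minus_inf x \<longleftrightarrow> z = Minus_inf x" for z by (cases z) auto
  then have "{z. \<exists>w. \<mu> z = Some w \<and> z \<le> Minus_inf x \<and> At x \<le> w} =
      {z. z = Minus_inf x \<and> (\<exists>w. \<mu> (Minus_inf x) = Some w \<and> At x \<le> w)}" by auto
  also have "\<dots> = (if local_type \<mu> x \<in> {A, C0, D} then {Minus_inf x} else {})"
    using c by (elim disjE; simp)
  finally show "homology_cover \<mu> (Before x) = of_bool (local_type \<mu> x \<in> {A, C0, D})"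
    by (simp add: homology_cover_def)
  have "z \<le> At x \<longleftrightarrow> z = Minus_inf x \<or> z = At x" for z by (cases z) auto
  then have "{z. \<exists>w. \<mu> z = Some w \<and> z \<le> At x \<and> Plus_inf x \<le> w} =
      {z. z = Minus_inf x \<and> (\<exists>w. \<mu> (Minus_inf x) = Some w \<and> Plus_inf x \<le> w)} \<union>
      {z. z = At x \<and> (\<exists>w. \<mu> (At x) = Some w \<and> Plus_inf x \<le> w)}" by auto
  also have "\<dots> = (if local_type \<mu> x \<in> {B, D} then {At x} else if local_type \<mu> x = C0 then {Minus_inf x} else {})"
    using c by (elim disjE; simp)
  finally show "homology_cover \<mu> (After x) = of_bool (local_type \<mu> x \<in> {B, C0, D})"
    by (simp add: homology_cover_def)
qed

lemma all_step: "(\<forall>\<sigma>. Q \<sigma>) \<longleftrightarrow> Q (Before p) \<and> Q (Before q) \<and> Q (After p) \<and> Q (After q)"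
  by (metis step.exhaust place.exhaust)

definition state :: "bool \<Rightarrow> idem" where
  "state i = (if i then {P} else {})"

lemma state_simps [simp]: "P \<in> state i \<longleftrightarrow> i" "state i \<subseteq> {P}" "state i = state j \<longleftrightarrow> i = j"
  by (auto simp: state_def)

lemma state_of: "s \<subseteq> {P} \<Longrightarrow> s = state (P \<in> s)"
  by (auto simp: state_def)

lemma idem_count_state: "idem_count (state i) = of_bool i"
  by (simp add: idem_count_def)

definition type_vec :: "bool \<Rightarrow> ltype \<Rightarrow> ltype \<Rightarrow> bool \<Rightarrow> vec" where
  "type_vec i a b j = V (diag_types (of_bool i) (pr a b) (of_bool j))"

definition type_cover :: "ltype \<Rightarrow> ltype \<Rightarrow> step \<Rightarrow> nat" where
  "type_cover a b \<sigma> = (case \<sigma> of Before x \<Rightarrow> of_bool (pr a b x \<in> {A, C0, D})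
     | After x \<Rightarrow> of_bool (pr a b x \<in> {B, C0, D}))"

lemma type_vec_simp:
  "type_vec i a b j = (\<Sum>c | core c = a. \<Sum>d | core d = b.
     if (if i then src c \<noteq> src d else \<not> src c \<and> \<not> src d) \<and>
        (if j then tgt c \<noteq> tgt d else \<not> tgt c \<and> \<not> tgt d) then TT c d else 0)"
  unfolding type_vec_def V_diag_types balanced_of_bool ..

lemma diag_type_vec:
  assumes "strand_diagram \<mu>" "\<And>z. \<mu> z \<noteq> Some z"
  shows "diag (state i) \<mu> (state j) = type_vec i (local_type \<mu> p) (local_type \<mu> q) j"
  unfolding type_vec_def diag_V[OF assms] idem_count_state using pr_eta[of "local_type \<mu>"] by simp

lemma homology_cover_type_cover:
  assumes "strand_diagram \<mu>" "\<And>z. \<mu> z \<noteq> Some z"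
  shows "homology_cover \<mu> = type_cover (local_type \<mu> p) (local_type \<mu> q)"
  by (simp add: fun_eq_iff all_step type_cover_def homology_cover_local_type[OF assms])

text \<open>The absence of fixed points leaves five types per interval; conversely
  \<open>mk_strands\<close> with the empty set realizes every pair of them without fixed
  points.\<close>

lemma diagram_hdata_iff:
  "diagram_hdata X (h, s, t) \<longleftrightarrow> (\<exists>i j. s = state i \<and> t = state j \<and>
     (\<exists>a\<in>{N0, A, B, C0, D}. \<exists>b\<in>{N0, A, B, C0, D}. X = type_vec i a b j \<and> X \<noteq> 0 \<and> h = type_cover a b))"
    (is "?L \<longleftrightarrow> ?R")
proof
  assume ?L
  then obtain \<mu> where st: "s \<subseteq> {P}" "t \<subseteq> {P}" and \<mu>: "strand_diagram \<mu>" "\<And>z. \<mu> z \<noteq> Some z"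
    and X: "X = diag s \<mu> t" "X \<noteq> 0" "h = homology_cover \<mu>"
    by (auto simp: diagram_hdata_def)
  have "local_type \<mu> x \<in> {N0, A, B, C0, D}" for x
    using local_type_cases_no_fixed[OF \<mu>, of x] by auto
  then show ?R
    using X state_of[OF st(1)] state_of[OF st(2)] diag_type_vec[OF \<mu>] homology_cover_type_cover[OF \<mu>]
    by metis
next
  assume ?R
  then obtain i j a b where st: "s = state i" "t = state j" and ab: "a \<in> {N0, A, B, C0, D}" "b \<in> {N0, A, B, C0, D}"
    and X: "X = type_vec i a b j" "X \<noteq> 0" "h = type_cover a b" by blast
  define \<mu> where "\<mu> = mk_strands (pr a b) {}"
  have "\<forall>z. \<mu> z \<noteq> Some z"
    unfolding all_point all_place \<mu>_def mk_strands_simps using ab by auto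
  moreover have "strand_diagram \<mu>" "local_type \<mu> = pr a b" by (simp_all add: \<mu>_def)
  ultimately show ?L
    using X st diag_type_vec[of \<mu> i j] homology_cover_type_cover[of \<mu>]
    by (auto simp: diagram_hdata_def)
qed

type_synonym index = "bool \<times> ltype \<times> ltype \<times> bool"

text \<open>The names of this and the next two sets are justified later, by computing the boundaries
  and the crossings. An entry lists the initial state, the types at \<open>p\<close> and
  \<open>q\<close>, and the final state.\<close>

definition tight_index :: "index set" where
  "tight_index = {
    (False, N0, N0, False), (True, N0, N0, True), (False, A, N0, True),
    (False, N0, A, True), (True, B, N0, False), (True, N0, B, False),
    (False, C0, N0, False), (False, N0, C0, False), (True, B, A, True),
    (True, A, B, True), (False, C0, A, True), (False, A, C0, True),
    (True, B, C0, False), (True, C0, B, False), (False, C0, C0, False),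
    (True, D, C0, True), (True, C0, D, True)}"

definition twisted_index :: "index set" where
  "twisted_index = {(True, D, N0, True), (True, N0, D, True)}"

definition crossed_index :: "index set" where
  "crossed_index = {(True, C0, N0, True), (True, N0, C0, True), (True, C0, C0, True)}"

definition diagram_index :: "index set" where
  "diagram_index = tight_index \<union> twisted_index \<union> crossed_index"

lemmas index_defs = tight_index_def twisted_index_def crossed_index_def diagram_index_def

lemma type_vec_values:
  "type_vec False N0 N0 False = TT N0 N0"
  "type_vec True N0 N0 True = TT N0 N1 + TT N1 N0"
  "type_vec False A N0 True = TT A N0"
  "type_vec False N0 A True = TT N0 A"
  "type_vec True B N0 False = TT B N0"
  "type_vec True N0 B False = TT N0 B"
  "type_vec False C0 N0 False = TT C0 N0"
  "type_vec False N0 C0 False = TT N0 C0"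
  "type_vec True B A True = TT B A"
  "type_vec True A B True = TT A B"
  "type_vec False C0 A True = TT C0 A"
  "type_vec False A C0 True = TT A C0"
  "type_vec True B C0 False = TT B C0"
  "type_vec True C0 B False = TT C0 B"
  "type_vec False C0 C0 False = TT C0 C0"
  "type_vec True D C0 True = TT D C0"
  "type_vec True C0 D True = TT C0 D"
  "type_vec True D N0 True = TT D N0"
  "type_vec True N0 D True = TT N0 D"
  "type_vec True C0 N0 True = TT C0 N1 + TT C1 N0"
  "type_vec True N0 C0 True = TT N0 C1 + TT N1 C0"
  "type_vec True C0 C0 True = TT C0 C1 + TT C1 C0"
  by (simp_all add: type_vec_simp core_fibres)

text \<open>A diagram vanishes as soon as no choice of horizontals at the places meets both
  idempotents. Running through all pairs of types leaves the listed indices.\<close>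

lemma type_vec_nonzero_index:
  assumes "type_vec i a b j \<noteq> 0"
  shows "(i, a, b, j) \<in> diagram_index"
proof -
  have "\<exists>c d. core c = a \<and> core d = b \<and> ((if i then src c \<noteq> src d else \<not> src c \<and> \<not> src d) \<and>
      (if j then tgt c \<noteq> tgt d else \<not> tgt c \<and> \<not> tgt d))" (is "\<exists>c d. _ \<and> _ \<and> ?ok c d")
  proof (rule ccontr)
    assume "\<not> ?thesis"
    then have "(if ?ok c d then TT c d else 0) = 0" if "core c = a" "core d = b" for c d
      using that by (metis (no_types))
    then have "type_vec i a b j = 0"
      unfolding type_vec_simp by (intro sum.neutral ballI) (simp only: mem_Collect_eq)
    with assms show False by metis
  qed
  then obtain c d where "core c = a" "core d = b" "?ok c d" by blast
  from \<open>?ok c d\<close> have "(i, core c, core d, j) \<in> diagram_index"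
    unfolding index_defs Un_iff insert_iff empty_iff prod.inject
    by (cases i; cases j; simp; cases c; simp; cases d; simp)
  with \<open>core c = a\<close> \<open>core d = b\<close> show ?thesis by simp
qed

lemma index_type_vec_nonzero:
  assumes "(i, a, b, j) \<in> diagram_index"
  shows "type_vec i a b j \<noteq> 0"
proof -
  \<comment> \<open>Where a dotted pair occurs, neither summand has the types \<open>a\<close>,
    \<open>b\<close> themselves; the second coefficient is that of the summand with the horizontal
    strand at \<open>p\<close>.\<close>
  have "coeff (type_vec i a b j) a b = 1 \<or> coeff (type_vec i a b j) (if a = N0 then N1 else C1) b = 1"
    using assms unfolding index_defs Un_iff insert_iff empty_iff prod.inject
    by (elim disjE conjE; simp add: type_vec_values)
  then show ?thesis by auto
qed

text \<open>
  A word records steps in the order in which the tight or twisted diagram factors into diagrams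
  with a single strand; for diagrams with crossings only the set of steps is meaningful.
\<close>

fun type_word :: "ltype \<Rightarrow> ltype \<Rightarrow> step list" where
  "type_word A N0 = [Before p]"
| "type_word N0 A = [Before q]"
| "type_word B N0 = [After p]"
| "type_word N0 B = [After q]"
| "type_word C0 N0 = [Before p, After p]"
| "type_word N0 C0 = [Before q, After q]"
| "type_word B A = [After p, Before q]"
| "type_word A B = [After q, Before p]"
| "type_word C0 A = [Before p, After p, Before q]"
| "type_word A C0 = [Before q, After q, Before p]"
| "type_word B C0 = [After p, Before q, After q]"
| "type_word C0 B = [After q, Before p, After p]"
| "type_word C0 C0 = [Before p, After p, Before q, After q]"
| "type_word D C0 = [After p, Before q, After q, Before p]"
| "type_word C0 D = [After q, Before p, After p, Before q]"
| "type_word D N0 = [After p, Before p]"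
| "type_word N0 D = [After q, Before q]"
| "type_word _ _ = []"

lemma type_cover_count:
  assumes "(i, a, b, j) \<in> diagram_index"
  shows "type_cover a b = count_list (type_word a b)"
proof -
  have "\<forall>\<sigma>. type_cover a b \<sigma> = count_list (type_word a b) \<sigma>"
    using assms unfolding index_defs Un_iff insert_iff empty_iff prod.inject all_step
    by (elim disjE conjE; simp add: type_cover_def)
  then show ?thesis by blast
qed

lemma diagram_hdata_index:
  "diagram_hdata X (h, s, t) \<longleftrightarrow> (\<exists>i a b j. (i, a, b, j) \<in> diagram_index \<and>
     s = state i \<and> t = state j \<and> X = type_vec i a b j \<and> h = count_list (type_word a b))"
proof -
  have "a \<in> {N0, A, B, C0, D} \<and> b \<in> {N0, A, B, C0, D}" if "(i, a, b, j) \<in> diagram_index" for i a b j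
    using that unfolding index_defs Un_iff insert_iff empty_iff prod.inject
    by (elim disjE conjE; simp)
  then show ?thesis
    unfolding diagram_hdata_iff using type_vec_nonzero_index index_type_vec_nonzero type_cover_count by metis
qed

declare plus_fun_apply [simp del] zero_fun_apply [simp del]

section \<open>Words in the one-strand diagrams\<close>

fun gen :: "step \<Rightarrow> vec" where
  "gen (Before x) = minus_strand x"
| "gen (After x) = plus_strand x"

lemma gen_TT:
  "gen (Before p) = TT A N0" "gen (Before q) = TT N0 A"
  "gen (After p) = TT B N0" "gen (After q) = TT N0 B"
proof -
  have sd: "strand_diagram [z \<mapsto> w]" if "z \<le> w" for z w
    using that by (auto simp: strand_diagram_def)
  have minus: "minus_strand x = type_vec False (if x = p then A else N0) (if x = q then A else N0) True" for x
  proof -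
    have "minus_strand x = diag (state False) [Minus_inf x \<mapsto> At x] (state True)"
      by (simp add: minus_strand_def state_def)
    also have "\<dots> = type_vec False (local_type [Minus_inf x \<mapsto> At x] p) (local_type [Minus_inf x \<mapsto> At x] q) True"
      by (rule diag_type_vec[OF sd]) (auto split: if_splits)
    finally show ?thesis by (cases x) (simp_all add: local_type_def)
  qed
  have plus: "plus_strand x = type_vec True (if x = p then B else N0) (if x = q then B else N0) False" for x
  proof -
    have "plus_strand x = diag (state True) [At x \<mapsto> Plus_inf x] (state False)"
      by (simp add: plus_strand_def state_def)
    also have "\<dots> = type_vec True (local_type [At x \<mapsto> Plus_inf x] p) (local_type [At x \<mapsto> Plus_inf x] q) False"
      by (rule diag_type_vec[OF sd]) (auto split: if_splits)
    finally show ?thesis by (cases x) (simp_all add: local_type_def)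
  qed
  show "gen (Before p) = TT A N0" "gen (Before q) = TT N0 A"
    "gen (After p) = TT B N0" "gen (After q) = TT N0 B"
    by (simp_all add: minus plus type_vec_values)
qed

declare gen.simps [simp del]

definition idem_vec :: "bool \<Rightarrow> vec" where
  "idem_vec i = diag (state i) Map.empty (state i)"

lemma idem_vec_type: "idem_vec i = type_vec i N0 N0 i"
proof -
  have "strand_diagram Map.empty" by (simp add: strand_diagram_def)
  from diag_type_vec[OF this, of i i] show ?thesis
    by (simp add: idem_vec_def local_type_def)
qed

lemma e0_idem_vec: "e0 = idem_vec False" and e1_idem_vec: "e1 = idem_vec True"
  by (simp_all add: e0_def e1_def idem_vec_def state_def)

definition word_val :: "bool \<Rightarrow> step list \<Rightarrow> vec" where
  "word_val i w = foldl (\<odot>) (idem_vec i) (map gen w)"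

fun path :: "bool \<Rightarrow> step list \<Rightarrow> bool \<Rightarrow> bool" where
  "path i [] j \<longleftrightarrow> i = j"
| "path i (Before x # w) j \<longleftrightarrow> \<not> i \<and> path True w j"
| "path i (After x # w) j \<longleftrightarrow> i \<and> path False w j"

text \<open>Crossed diagrams are left out: a composite has type \<open>C1\<close> only if a factor
  has it, so words in one-strand diagrams never produce crossings.\<close>

lemma word_val_index:
  assumes "(i, a, b, j) \<in> tight_index \<union> twisted_index"
  shows "word_val i (type_word a b) = type_vec i a b j"
  using assms unfolding index_defs Un_iff insert_iff empty_iff prod.inject
  by (elim disjE conjE; simp add: word_val_def idem_vec_type type_vec_values gen_TT mult_TT mult_add_left)

lemma path_index:
  assumes "(i, a, b, j) \<in> tight_index \<union> twisted_index"
  shows "path i (type_word a b) j" "distinct (type_word a b)"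
  using assms unfolding index_defs Un_iff insert_iff empty_iff prod.inject
  by (elim disjE conjE; simp)+

section \<open>Homology\<close>

definition bd :: "vec set" where
  "bd = span2 {TT D N0, TT N0 D, TT D C0 + TT C0 D}"

lemma bd_zero [simp]: "0 \<in> bd"
  by (simp add: bd_def span2_zero)

lemma bd_add: "X \<in> bd \<Longrightarrow> Y \<in> bd \<Longrightarrow> X + Y \<in> bd"
  by (simp add: bd_def span2_add)

lemma bd_gens: "TT D N0 \<in> bd" "TT N0 D \<in> bd" "TT D C0 + TT C0 D \<in> bd"
  by (simp_all add: bd_def span2_base)

lemma bd_induct [consumes 1, case_names zero add one two three]:
  assumes "X \<in> bd" "Q 0" "\<And>X Y. Q X \<Longrightarrow> Q Y \<Longrightarrow> Q (X + Y)"
    and "Q (TT D N0)" "Q (TT N0 D)" "Q (TT D C0 + TT C0 D)"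
  shows "Q X"
proof -
  have "bd \<subseteq> Collect Q"
    unfolding bd_def by (rule span2_subset) (use assms in auto)
  with assms(1) show ?thesis by blast
qed

text \<open>These linear conditions detect when a sum of diagrams is not a boundary; the second says
  that \<open>TT D C0\<close> and \<open>TT C0 D\<close> occur only together.\<close>

lemma coeff_bd:
  assumes "X \<in> bd"
  shows "(a, b) \<notin> {(D, N0), (N0, D), (D, C0), (C0, D)} \<Longrightarrow> coeff X a b = 0"
    and "coeff X D C0 = coeff X C0 D"
proof -
  have "((a, b) \<notin> {(D, N0), (N0, D), (D, C0), (C0, D)} \<longrightarrow> coeff X a b = 0) \<and> coeff X D C0 = coeff X C0 D"
    by (rule bd_induct[OF assms]) auto
  then show "(a, b) \<notin> {(D, N0), (N0, D), (D, C0), (C0, D)} \<Longrightarrow> coeff X a b = 0"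
    and "coeff X D C0 = coeff X C0 D" by blast+
qed

lemma is_diagram_iff: "is_diagram X \<longleftrightarrow> (\<exists>i a b j. (i, a, b, j) \<in> diagram_index \<and> X = type_vec i a b j)"
  unfolding is_diagram_def using diagram_hdata_index by (metis surj_pair)

lemma is_diagram_algebra: "is_diagram X \<Longrightarrow> X \<in> \<A>"
  by (simp add: strand_algebra_def span2_base)

lemma algebra_add: "X \<in> \<A> \<Longrightarrow> Y \<in> \<A> \<Longrightarrow> X + Y \<in> \<A>"
  by (simp add: strand_algebra_def span2_add)

lemma algebra_zero: "0 \<in> \<A>"
  by (simp add: strand_algebra_def span2_zero)

lemma diff_index:
  "(i, a, b, j) \<in> tight_index \<union> twisted_index \<Longrightarrow> \<partial> (type_vec i a b j) = 0"
  "(i, a, b, j) \<in> crossed_index \<Longrightarrow> \<partial> (type_vec i a b j) \<in> bd"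
  "(i, a, b, j) \<in> crossed_index \<Longrightarrow> \<partial> (type_vec i a b j) \<noteq> 0"
proof -
  show "(i, a, b, j) \<in> tight_index \<union> twisted_index \<Longrightarrow> \<partial> (type_vec i a b j) = 0"
    unfolding index_defs Un_iff insert_iff empty_iff prod.inject
    by (elim disjE conjE; simp add: type_vec_values diff_TT diff_add)
  show "(i, a, b, j) \<in> crossed_index \<Longrightarrow> \<partial> (type_vec i a b j) \<in> bd"
    unfolding index_defs Un_iff insert_iff empty_iff prod.inject
    using bd_gens by (elim disjE conjE; simp add: type_vec_values diff_TT diff_add add.commute)
  assume "(i, a, b, j) \<in> crossed_index"
  then have "coeff (\<partial> (type_vec i a b j)) D b = 1 \<or> coeff (\<partial> (type_vec i a b j)) a D = 1"
    unfolding index_defs Un_iff insert_iff empty_iff prod.inject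
    by (elim disjE conjE; simp add: type_vec_values diff_TT diff_add)
  then show "\<partial> (type_vec i a b j) \<noteq> 0" by auto
qed

text \<open>Only the three crossed diagrams have nonzero differential, and their differentials are
  the three spanning vectors.\<close>

lemma boundaries_eq: "boundaries = bd"
proof
  have "\<A> \<subseteq> {X. \<partial> X \<in> bd}"
    unfolding strand_algebra_def
  proof (rule span2_subset)
    show "{X. is_diagram X} \<subseteq> {X. \<partial> X \<in> bd}"
      using diff_index by (auto simp: is_diagram_iff diagram_index_def)
  qed (auto simp: diff_add bd_add)
  then show "boundaries \<subseteq> bd" by (auto simp: boundaries_def)
next
  have crossed: "type_vec i a b j \<in> \<A>" if "(i, a, b, j) \<in> crossed_index" for i a b j
    using that by (intro is_diagram_algebra) (auto simp: is_diagram_iff diagram_index_def)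
  have "TT D N0 = \<partial> (type_vec True C0 N0 True)" "TT N0 D = \<partial> (type_vec True N0 C0 True)"
    "TT D C0 + TT C0 D = \<partial> (type_vec True C0 C0 True)"
    by (simp_all add: type_vec_values diff_TT diff_add add.commute)
  moreover have "type_vec True C0 N0 True \<in> \<A>" "type_vec True N0 C0 True \<in> \<A>" "type_vec True C0 C0 True \<in> \<A>"
    by (rule crossed; simp add: crossed_index_def)+
  ultimately have "{TT D N0, TT N0 D, TT D C0 + TT C0 D} \<subseteq> boundaries"
    by (auto simp: boundaries_def)
  then show "bd \<subseteq> boundaries"
    unfolding bd_def
  proof (rule span2_subset)
    show "0 \<in> boundaries"
      unfolding boundaries_def using algebra_zero diff_zero by (metis rev_image_eqI)
    show "\<And>X Y. X \<in> boundaries \<Longrightarrow> Y \<in> boundaries \<Longrightarrow> X + Y \<in> boundaries"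
      unfolding boundaries_def using algebra_add diff_add by (metis (no_types, opaque_lifting) imageE rev_image_eqI)
  qed
qed

lemma mem_hclass_of: "Y \<in> hclass_of X \<longleftrightarrow> Y \<in> cycles \<and> X + Y \<in> bd"
  by (simp add: hclass_of_def boundaries_eq vec_diff_eq_add add.commute)

lemma hclass_of_eqI:
  assumes "X + Y \<in> bd"
  shows "hclass_of X = hclass_of Y"
proof -
  have "Y + Z \<in> bd" if "X + Z \<in> bd" for Z
    using bd_add[OF assms that] by (simp only: add.assoc[symmetric] add.commute[of X Y])
      (simp only: add.assoc vec_add_self_left)
  moreover have "X + Z \<in> bd" if "Y + Z \<in> bd" for Z
    using bd_add[OF assms that] by (simp only: add.assoc vec_add_self_left)
  ultimately show ?thesis by (auto simp: mem_hclass_of)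
qed

lemma hclass_of_eqD:
  assumes "hclass_of X = hclass_of Y" "X \<in> cycles"
  shows "X + Y \<in> bd"
proof -
  have "X \<in> hclass_of X" using assms(2) by (simp add: mem_hclass_of)
  with assms(1) show ?thesis by (simp add: mem_hclass_of add.commute)
qed

lemma index_cycles:
  assumes "(i, a, b, j) \<in> tight_index \<union> twisted_index"
  shows "type_vec i a b j \<in> cycles"
proof -
  have "is_diagram (type_vec i a b j)"
    unfolding is_diagram_iff diagram_index_def using assms by blast
  then show ?thesis
    using is_diagram_algebra diff_index(1)[OF assms] by (simp add: cycles_def)
qed

lemma twisted_class_zero:
  assumes "(i, a, b, j) \<in> twisted_index"
  shows "hclass_of (type_vec i a b j) = hclass_of 0"
  using assms bd_gens unfolding index_defs Un_iff insert_iff empty_iff prod.inject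
  by (intro hclass_of_eqI) (elim disjE conjE; simp add: type_vec_values)

lemma coeff_type_vec:
  "coeff (type_vec i a b j) c d = (if core c = a \<and> core d = b \<and>
     (if i then src c \<noteq> src d else \<not> src c \<and> \<not> src d) \<and>
     (if j then tgt c \<noteq> tgt d else \<not> tgt c \<and> \<not> tgt d) then 1 else 0)"
proof -
  have "pr c d \<in> diag_types (of_bool i) (pr a b) (of_bool j) \<longleftrightarrow> core c = a \<and> core d = b \<and>
     (if i then src c \<noteq> src d else \<not> src c \<and> \<not> src d) \<and>
     (if j then tgt c \<noteq> tgt d else \<not> tgt c \<and> \<not> tgt d)"
    unfolding balanced_of_bool [symmetric] diag_types_def mem_Collect_eq card_places all_place pr_simps
      balanced_def by blast
  moreover have "coeff (type_vec i a b j) c d =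
      (if pr c d \<in> diag_types (of_bool i) (pr a b) (of_bool j) then 1 else 0)"
    by (simp add: coeff_def type_vec_def V_ind ind_def)
  ultimately show ?thesis by (simp del: src.simps tgt.simps)
qed

text \<open>The cores recover the moving strands, and the occupied places recover both states.
  Distinct diagrams therefore share no types.\<close>

lemma coeff_type_vec_inj:
  assumes "coeff (type_vec i a b j) c d = 1" "coeff (type_vec i' a' b' j') c d = 1"
  shows "(i, a, b, j) = (i', a', b', j')"
  using assms unfolding coeff_type_vec by (auto split: if_splits simp del: src.simps tgt.simps)

text \<open>
  The exceptional pair is the boundary of the diagram with two long strands and a dotted pair.
\<close>

lemma tight_class_eq:
  assumes "(i, a, b, j) \<in> tight_index" "(i', a', b', j') \<in> tight_index"
    and "hclass_of (type_vec i a b j) = hclass_of (type_vec i' a' b' j')"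
  shows "(i, a, b, j) = (i', a', b', j') \<or>
    {(i, a, b, j), (i', a', b', j')} = {(True, D, C0, True), (True, C0, D, True)}"
proof -
  have bd: "type_vec i a b j + type_vec i' a' b' j' \<in> bd"
    using assms by (intro hclass_of_eqD index_cycles) auto
  show ?thesis
  proof (cases "a = D \<or> b = D")
    case False
    \<comment> \<open>The diagram \<open>e1\<close> is detected at its summand with the horizontal
      strand at \<open>p\<close>; every other tight diagram without \<open>D\<close> is a single
      type sum.\<close>
    define c where "c = (if i \<and> a = N0 \<and> b = N0 then N1 else a)"
    have c: "coeff (type_vec i a b j) c b = 1"
      using assms(1) unfolding index_defs Un_iff insert_iff empty_iff prod.inject
      by (elim disjE conjE; simp add: type_vec_values c_def)
    have "(c, b) \<notin> {(D, N0), (N0, D), (D, C0), (C0, D)}"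
      using False by (auto simp: c_def split: if_splits)
    then have "coeff (type_vec i' a' b' j') c b = 1"
      using coeff_bd(1)[OF bd, of c b] c by (cases "coeff (type_vec i' a' b' j') c b") simp_all
    with c show ?thesis using coeff_type_vec_inj by blast
  next
    case True
    then have k: "(i, a, b, j) = (True, D, C0, True) \<or> (i, a, b, j) = (True, C0, D, True)"
      using assms(1) by (auto simp: tight_index_def)
    then have "coeff (type_vec i a b j) D C0 \<noteq> coeff (type_vec i a b j) C0 D"
      by (elim disjE) (simp_all add: type_vec_values)
    \<comment> \<open>A boundary has equal coefficients at these two positions, while the first
      diagram has unequal ones; so the second diagram must contain one of the two terms.\<close>
    with coeff_bd(2)[OF bd] have "coeff (type_vec i' a' b' j') D C0 = 1 \<or> coeff (type_vec i' a' b' j') C0 D = 1"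
      by (cases "coeff (type_vec i a b j) D C0"; cases "coeff (type_vec i a b j) C0 D";
          cases "coeff (type_vec i' a' b' j') D C0"; cases "coeff (type_vec i' a' b' j') C0 D") simp_all
    moreover have "coeff (type_vec True D C0 True) D C0 = 1" "coeff (type_vec True C0 D True) C0 D = 1"
      by (simp_all add: type_vec_values)
    ultimately have "(i', a', b', j') = (True, D, C0, True) \<or> (i', a', b', j') = (True, C0, D, True)"
      using coeff_type_vec_inj by metis
    with k show ?thesis by blast
  qed
qed

lemma tight_class_nonzero:
  assumes "(i, a, b, j) \<in> tight_index"
  shows "hclass_of (type_vec i a b j) \<noteq> hclass_of 0"
proof
  assume "hclass_of (type_vec i a b j) = hclass_of 0"
  then have bd: "type_vec i a b j + 0 \<in> bd"
    using assms by (intro hclass_of_eqD index_cycles) auto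
  define c where "c = (if i \<and> a = N0 \<and> b = N0 then N1 else a)"
  have "(c, b) \<notin> {(D, N0), (N0, D), (D, C0), (C0, D)} \<and> coeff (type_vec i a b j) c b = 1 \<or>
    coeff (type_vec i a b j) D C0 \<noteq> coeff (type_vec i a b j) C0 D"
    using assms unfolding index_defs Un_iff insert_iff empty_iff prod.inject
    by (elim disjE conjE; simp add: type_vec_values c_def)
  with coeff_bd(1)[OF bd, of c b] coeff_bd(2)[OF bd] show False by simp
qed


section \<open>Crossings, tight and twisted diagrams\<close>

lemma supp_type_vec:
  "supp (type_vec i a b j) = {\<phi>. strand_diagram \<phi> \<and> local_type \<phi> \<in> diag_types (of_bool i) (pr a b) (of_bool j)}"
  by (simp add: type_vec_def V_ind)

text \<open>Type \<open>C1\<close> uses up the one occupied place both at the start and at the end,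
  so the other interval has type \<open>N0\<close> or \<open>C0\<close>; this gives precisely the
  crossed indices.\<close>

lemma has_crossings_index:
  assumes "(i, a, b, j) \<in> diagram_index"
  shows "has_crossings (type_vec i a b j) \<longleftrightarrow> (i, a, b, j) \<in> crossed_index"
proof
  assume "has_crossings (type_vec i a b j)"
  then obtain \<phi> x where \<phi>: "strand_diagram \<phi>" "local_type \<phi> \<in> diag_types (of_bool i) (pr a b) (of_bool j)"
    "local_type \<phi> x = C1"
    by (auto simp: has_crossings_def supp_type_vec crossings_local_type)
  let ?c = "local_type \<phi> p" and ?d = "local_type \<phi> q"
  have "balanced (of_bool i) ?c ?d (of_bool j)" "core ?c = a" "core ?d = b" "?c = C1 \<or> ?d = C1"
    using \<phi>(2,3) unfolding diag_types_def mem_Collect_eq card_places all_place pr_simps balanced_def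
    by (auto intro: place.exhaust[of x] simp del: src.simps tgt.simps)
  then show "(i, a, b, j) \<in> crossed_index"
    unfolding balanced_of_bool
    by (cases i; cases j; elim disjE; cases ?c; simp; cases ?d; simp add: crossed_index_def)
next
  assume "(i, a, b, j) \<in> crossed_index"
  then have "\<exists>c d. (c = C1 \<or> d = C1) \<and> coeff (type_vec i a b j) c d = 1"
    unfolding crossed_index_def insert_iff empty_iff prod.inject
    by (intro exI[of _ "if a = C0 then C1 else N0"] exI[of _ "if a = C0 then b else C1"])
      (elim disjE conjE; simp add: type_vec_values)
  then obtain c d where cd: "c = C1 \<or> d = C1" "coeff (type_vec i a b j) c d = 1" by blast
  let ?\<phi> = "mk_strands (pr c d) {}"
  have "\<exists>x. local_type ?\<phi> x = C1" using cd(1) by (auto simp: ex_place)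
  then have "crossings ?\<phi> \<noteq> {}" by (auto simp: crossings_local_type)
  moreover have "?\<phi> \<in> supp (type_vec i a b j)" using cd(2) by (simp add: supp_def coeff_def)
  ultimately show "has_crossings (type_vec i a b j)" by (auto simp: has_crossings_def)
qed

lemma index_disjoint: "k \<in> tight_index \<union> twisted_index \<Longrightarrow> k \<notin> crossed_index"
  by (auto simp: index_defs)

lemma tight_diagram_iff:
  "tight_diagram X \<longleftrightarrow> (\<exists>i a b j. (i, a, b, j) \<in> tight_index \<and> X = type_vec i a b j)"
proof
  assume X: "tight_diagram X"
  then obtain i a b j where k: "(i, a, b, j) \<in> diagram_index" "X = type_vec i a b j"
    by (auto simp: tight_diagram_def is_diagram_iff)
  with X have "(i, a, b, j) \<in> tight_index"
    using twisted_class_zero has_crossings_index[OF k(1)] by (auto simp: tight_diagram_def diagram_index_def)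
  with k show "\<exists>i a b j. (i, a, b, j) \<in> tight_index \<and> X = type_vec i a b j" by blast
next
  assume "\<exists>i a b j. (i, a, b, j) \<in> tight_index \<and> X = type_vec i a b j"
  then show "tight_diagram X"
    unfolding tight_diagram_def is_diagram_iff
    using has_crossings_index index_disjoint tight_class_nonzero unfolding diagram_index_def by (metis UnCI)
qed

lemma twisted_diagramI: "(i, a, b, j) \<in> twisted_index \<Longrightarrow> twisted_diagram (type_vec i a b j)"
  unfolding twisted_diagram_def is_diagram_iff
  using has_crossings_index index_disjoint twisted_class_zero unfolding diagram_index_def by (metis UnCI)

text \<open>A diagram representing a nonzero class is tight, since crossed diagrams are not cycles
  and twisted ones are boundaries.\<close>

lemma class_hdata_nonzero:
  assumes "class_hdata M (h, s, t)" "M \<noteq> hclass_of 0"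
  obtains i a b j where "(i, a, b, j) \<in> tight_index" "s = state i" "t = state j"
    "h = count_list (type_word a b)" "M = hclass_of (type_vec i a b j)"
proof -
  obtain X where X: "diagram_hdata X (h, s, t)" "\<partial> X = 0" "M = hclass_of X"
    using assms(1) by (auto simp: class_hdata_def)
  then obtain i a b j where k: "(i, a, b, j) \<in> diagram_index" "s = state i" "t = state j"
    "X = type_vec i a b j" "h = count_list (type_word a b)"
    by (auto simp: diagram_hdata_index)
  moreover have "(i, a, b, j) \<notin> crossed_index"
    using diff_index(3) X(2) k(4) by blast
  moreover have "(i, a, b, j) \<notin> twisted_index"
    using twisted_class_zero X(3) k(4) assms(2) by metis
  ultimately have "(i, a, b, j) \<in> tight_index"
    by (simp add: diagram_index_def)
  with k show thesis using X(3) that by metis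
qed

lemma class_hdata_index:
  assumes "(i, a, b, j) \<in> tight_index"
  shows "class_hdata (hclass_of (type_vec i a b j)) (count_list (type_word a b), state i, state j)"
  unfolding class_hdata_def using assms diff_index(1) diagram_hdata_index diagram_index_def by (metis UnCI)

section \<open>Products of homology classes\<close>

lemma mult_bd_zero:
  assumes "X \<odot> TT D N0 = 0" "X \<odot> TT N0 D = 0" "X \<odot> TT D C0 + X \<odot> TT C0 D = 0" "Y \<in> bd"
  shows "X \<odot> Y = 0"
  by (rule bd_induct[OF assms(4)]) (use assms(1-3) in \<open>simp_all add: mult_add_right\<close>)

lemma bd_mult_zero:
  assumes "TT D N0 \<odot> X = 0" "TT N0 D \<odot> X = 0" "TT D C0 \<odot> X + TT C0 D \<odot> X = 0" "Y \<in> bd"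
  shows "Y \<odot> X = 0"
  by (rule bd_induct[OF assms(4)]) (use assms(1-3) in \<open>simp_all add: mult_add_left\<close>)

lemma step_cases:
  obtains "\<sigma> = Before p" | "\<sigma> = Before q" | "\<sigma> = After p" | "\<sigma> = After q"
  by (metis step.exhaust place.exhaust)

text \<open>Every term of a spanning boundary has type \<open>D\<close> on some interval, and
  \<open>D\<close> composes on the right only with \<open>N1\<close>, which no one-strand diagram
  has.\<close>

lemma bd_mult_gen:
  assumes "Y \<in> bd"
  shows "Y \<odot> gen \<sigma> = 0"
  by (rule bd_mult_zero[OF _ _ _ assms]; cases \<sigma> rule: step_cases; simp add: gen_TT mult_TT)

lemma bd_mult_bd:
  assumes "Y \<in> bd" "Z \<in> bd"
  shows "Y \<odot> Z = 0"
proof -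
  have "TT D N0 \<odot> Z = 0" "TT N0 D \<odot> Z = 0" "TT D C0 \<odot> Z = 0" "TT C0 D \<odot> Z = 0"
    by (rule mult_bd_zero[OF _ _ _ assms(2)]; simp add: mult_TT)+
  then show ?thesis by (intro bd_mult_zero[OF _ _ _ assms(1)]) simp_all
qed

text \<open>When boundaries are annihilated on both sides, the product is the same vector for all
  representatives, and the union defining the product of classes consists of copies of one coset.
  The conditions on \<open>X\<close> fail for \<open>e1\<close>, which acts as the identity on
  boundaries; so classes are multiplied letter by letter without a leading idempotent.\<close>

lemma hmult_gen:
  assumes X: "X \<in> cycles" "X \<odot> TT D N0 = 0" "X \<odot> TT N0 D = 0" "X \<odot> TT D C0 + X \<odot> TT C0 D = 0"
    and gen: "gen \<sigma> \<in> cycles"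
  shows "hmult (hclass_of X) (hclass_of (gen \<sigma>)) = hclass_of (X \<odot> gen \<sigma>)"
proof -
  have *: "X' \<odot> Y' = X \<odot> gen \<sigma>" if "X' \<in> hclass_of X" "Y' \<in> hclass_of (gen \<sigma>)" for X' Y'
  proof -
    define Y Z where "Y = X + X'" and "Z = gen \<sigma> + Y'"
    then have bd: "Y \<in> bd" "Z \<in> bd" and eq: "X' = X + Y" "Y' = gen \<sigma> + Z"
      using that unfolding mem_hclass_of by (simp_all only: vec_add_self_left)
    have "X' \<odot> Y' = X \<odot> gen \<sigma> + Y \<odot> gen \<sigma> + (X \<odot> Z + Y \<odot> Z)"
      unfolding eq by (simp only: mult_add_left mult_add_right)
    also have "\<dots> = X \<odot> gen \<sigma>"
      by (simp only: mult_bd_zero[OF X(2-4) bd(2)] bd_mult_gen[OF bd(1)] bd_mult_bd[OF bd] add_0_right)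
    finally show ?thesis .
  qed
  have "X \<in> hclass_of X" "gen \<sigma> \<in> hclass_of (gen \<sigma>)"
    using X(1) gen by (simp_all add: mem_hclass_of)
  \<comment> \<open>Nonemptiness matters, since a union over an empty coset would not collapse to
    the class of the product.\<close>
  then have ne: "hclass_of X \<noteq> {}" "hclass_of (gen \<sigma>) \<noteq> {}" by blast+
  have "hmult (hclass_of X) (hclass_of (gen \<sigma>)) =
      (\<Union>X'\<in>hclass_of X. \<Union>Y'\<in>hclass_of (gen \<sigma>). hclass_of (X \<odot> gen \<sigma>))"
    unfolding hmult_def by (intro SUP_cong refl arg_cong[of _ _ hclass_of] *)
  also have "\<dots> = hclass_of (X \<odot> gen \<sigma>)"
    using ne by (simp only: UN_constant if_False)
  finally show ?thesis .
qed

lemma gen_cycles: "gen \<sigma> \<in> cycles"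
proof -
  have "\<exists>i a b j. (i, a, b, j) \<in> tight_index \<and> gen \<sigma> = type_vec i a b j"
    by (cases \<sigma> rule: step_cases; simp add: gen_TT tight_index_def; metis type_vec_values)
  then obtain i a b j where "(i, a, b, j) \<in> tight_index" "gen \<sigma> = type_vec i a b j" by blast
  then show ?thesis using index_cycles[of i a b j] by simp
qed

lemma hprod_word:
  assumes "(i, a, b, j) \<in> tight_index" "type_word a b \<noteq> []"
  shows "hprod (map (\<lambda>\<sigma>. hclass_of (gen \<sigma>)) (type_word a b)) = hclass_of (type_vec i a b j)"
proof -
  \<comment> \<open>The types of the tight diagrams with a nonempty word, apart from the two
    containing \<open>D\<close>. They include every partial product that is multiplied further, and
    none contains \<open>N1\<close>.\<close>
  let ?K = "{(A, N0), (N0, A), (B, N0), (N0, B), (C0, N0), (N0, C0), (B, A), (A, B), (C0, A), (A, C0),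
      (B, C0), (C0, B), (C0, C0)}"
  have cycles: "TT c d \<in> cycles" if K: "(c, d) \<in> ?K" for c d
  proof -
    have "\<exists>i j. (i, c, d, j) \<in> tight_index \<and> type_vec i c d j = TT c d"
      using K unfolding insert_iff empty_iff prod.inject
      by (elim disjE conjE; simp add: tight_index_def ex_bool_eq type_vec_values)
    then obtain i j where "(i, c, d, j) \<in> tight_index" "type_vec i c d j = TT c d" by blast
    then show ?thesis using index_cycles[of i c d j] by simp
  qed
  have hmult: "hmult (hclass_of (TT c d)) (hclass_of (TT c' d')) = hclass_of (TT c d \<odot> TT c' d')"
    if K: "(c, d) \<in> ?K" and gen: "(c', d') \<in> {(A, N0), (N0, A), (B, N0), (N0, B)}" for c d c' d'
  proof -
    have "\<exists>\<sigma>. TT c' d' = gen \<sigma>"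
      using gen gen_TT unfolding insert_iff empty_iff prod.inject by (elim disjE conjE) metis+
    then obtain \<sigma> where \<sigma>: "TT c' d' = gen \<sigma>" by blast
    have "TT c d \<odot> TT D N0 = 0" "TT c d \<odot> TT N0 D = 0" "TT c d \<odot> TT D C0 + TT c d \<odot> TT C0 D = 0"
      using K unfolding insert_iff empty_iff prod.inject by (elim disjE conjE; simp add: mult_TT)+
    then show ?thesis unfolding \<sigma> by (intro hmult_gen gen_cycles cycles K)
  qed
  show ?thesis
    using assms unfolding tight_index_def insert_iff empty_iff prod.inject
    by (elim disjE conjE; simp add: type_vec_values hprod_def gen_TT hmult mult_TT)
qed

section \<open>Tensor products as paths\<close>

definition ivec :: "index \<Rightarrow> vec" where
  "ivec = (\<lambda>(i, a, b, j). type_vec i a b j)"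

definition iword :: "index \<Rightarrow> step list" where
  "iword = (\<lambda>(i, a, b, j). type_word a b)"

definition icls :: "index \<Rightarrow> hclass" where
  "icls k = hclass_of (ivec k)"

definition idat :: "index \<Rightarrow> hdata" where
  "idat k = (count_list (iword k), state (fst k), state (snd (snd (snd k))))"

fun ipath :: "bool \<Rightarrow> index list \<Rightarrow> bool \<Rightarrow> bool" where
  "ipath i [] j \<longleftrightarrow> i = j"
| "ipath i ((i', a, b, j') # ks) j \<longleftrightarrow> i = i' \<and> ipath j' ks j"

definition iwords :: "index list \<Rightarrow> step list" where
  "iwords ks = concat (map iword ks)"

lemma iwords_simps [simp]:
  "iwords [] = []" "iwords (k # ks) = iword k @ iwords ks" "iwords (ks @ ks') = iwords ks @ iwords ks'"
  by (simp_all add: iwords_def)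

lemma ivec_simp: "ivec (i, a, b, j) = type_vec i a b j"
  and iword_simp: "iword (i, a, b, j) = type_word a b"
  by (simp_all add: ivec_def iword_def)

lemma ipath_append: "ipath i (ks @ ks') j \<longleftrightarrow> (\<exists>m. ipath i ks m \<and> ipath m ks' j)"
  by (induction ks arbitrary: i) auto

lemma path_append: "path i (w @ w') j \<longleftrightarrow> (\<exists>m. path i w m \<and> path m w' j)"
proof (induction w arbitrary: i)
  case (Cons \<sigma> w)
  then show ?case by (cases \<sigma>) auto
qed simp

lemma path_iwords:
  assumes "ipath i ks j" "set ks \<subseteq> tight_index"
  shows "path i (iwords ks) j"
  using assms
proof (induction ks arbitrary: i)
  case (Cons k ks)
  obtain i' a b j' where k: "k = (i', a, b, j')" by (rule prod_cases4)
  then have "(i', a, b, j') \<in> tight_index \<union> twisted_index" using Cons.prems by simp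
  from path_index(1)[OF this] Cons k show ?case by (auto simp: path_append iword_simp)
qed simp

definition igen :: "step \<Rightarrow> index" where
  "igen \<sigma> = (case \<sigma> of Before x \<Rightarrow> (False, if x = p then A else N0, if x = q then A else N0, True)
     | After x \<Rightarrow> (True, if x = p then B else N0, if x = q then B else N0, False))"

lemma igen_props [simp]:
  "igen \<sigma> \<in> tight_index" "ivec (igen \<sigma>) = gen \<sigma>" "iword (igen \<sigma>) = [\<sigma>]"
  by (cases \<sigma> rule: step_cases; simp add: igen_def tight_index_def ivec_def iword_def gen_TT type_vec_values)+

lemma iwords_igen [simp]: "iwords (map igen w) = w"
  by (induction w) simp_all

lemma ipath_igen: "ipath i (map igen w) j \<longleftrightarrow> path i w j"
proof (induction w arbitrary: i)
  case (Cons \<sigma> w)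
  then show ?case by (cases \<sigma>) (auto simp: igen_def)
qed simp

lemma idem_index_tight: "(i, N0, N0, i) \<in> tight_index"
  by (simp add: tight_index_def)

lemma iword_empty:
  assumes "(i, a, b, j) \<in> tight_index" "type_word a b = []"
  shows "a = N0 \<and> b = N0 \<and> i = j"
  using assms unfolding tight_index_def insert_iff empty_iff prod.inject
  by (elim disjE conjE; simp)

lemma count_list_le_1_iff: "(\<forall>\<sigma>. count_list w \<sigma> \<le> 1) \<longleftrightarrow> distinct w"
proof (induction w)
  case (Cons \<tau> w)
  have "(\<forall>\<sigma>. count_list (\<tau> # w) \<sigma> \<le> 1) \<longleftrightarrow> count_list w \<tau> = 0 \<and> (\<forall>\<sigma>. count_list w \<sigma> \<le> 1)"
    by (auto split: if_splits intro: le_SucI)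
  then show ?case using Cons by (simp add: count_list_0_iff)
qed simp

lemma class_hdata_icls:
  assumes "k \<in> tight_index"
  shows "class_hdata (icls k) (idat k)"
proof -
  obtain i a b j where k: "k = (i, a, b, j)" by (rule prod_cases4)
  with assms class_hdata_index show ?thesis
    by (simp add: icls_def idat_def ivec_simp iword_simp)
qed

lemma sum_idat: "(\<Sum>d\<leftarrow>map idat ks. fst d \<sigma>) = count_list (iwords ks) \<sigma>"
  by (induction ks) (simp_all add: idat_def)

section \<open>Viability in terms of paths\<close>

lemma chain_Cons:
  assumes "ds \<noteq> []"
  shows "(\<forall>n. Suc n < length (d # ds) \<longrightarrow> Q ((d # ds) ! n) ((d # ds) ! Suc n)) \<longleftrightarrow>
    Q d (hd ds) \<and> (\<forall>n. Suc n < length ds \<longrightarrow> Q (ds ! n) (ds ! Suc n))" (is "?L \<longleftrightarrow> ?R")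
proof
  assume L: ?L
  have "Q (ds ! n) (ds ! Suc n)" if "Suc n < length ds" for n
    using L[rule_format, of "Suc n"] that by simp
  with L[rule_format, of 0] assms show ?R by (simp add: hd_conv_nth)
next
  assume R: ?R
  show ?L
  proof (intro allI impI)
    fix n assume "Suc n < length (d # ds)"
    with R assms show "Q ((d # ds) ! n) ((d # ds) ! Suc n)"
      by (cases n) (simp_all add: hd_conv_nth)
  qed
qed

lemma ipath_chain:
  assumes "ks \<noteq> []"
  shows "ipath i ks j \<longleftrightarrow> state i = fst (snd (hd (map idat ks))) \<and> state j = snd (snd (last (map idat ks))) \<and>
    (\<forall>n. Suc n < length (map idat ks) \<longrightarrow> snd (snd (map idat ks ! n)) = fst (snd (map idat ks ! Suc n)))"
  using assms
proof (induction ks arbitrary: i rule: list_nonempty_induct)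
  case (single k)
  then show ?case by (cases k) (auto simp: idat_def)
next
  case (cons k ks)
  obtain i' a b j' where k: "k = (i', a, b, j')" by (rule prod_cases4)
  have ne: "map idat ks \<noteq> []" using cons.hyps by simp
  have "ipath i (k # ks) j \<longleftrightarrow> i = i' \<and> ipath j' ks j" by (simp add: k)
  then show ?case
    unfolding cons.IH list.map chain_Cons[OF ne, of "idat k" "\<lambda>d d'. snd (snd d) = fst (snd d')"]
      list.sel(1) last_ConsR[OF ne]
    by (auto simp: k idat_def)
qed

lemma viable_with_icls:
  assumes "ks \<noteq> []" "set ks \<subseteq> tight_index" "ipath i ks j" "distinct (iwords ks)"
  shows "viable_with (map icls ks) (count_list (iwords ks), state i, state j)"
  unfolding viable_with_def prod.case
proof (intro exI[of _ "map idat ks"] conjI)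
  show "list_all2 class_hdata (map icls ks) (map idat ks)"
    using assms(2) by (auto simp: list_all2_map1 list_all2_map2 intro!: list.rel_refl_strong class_hdata_icls)
  show "map idat ks \<noteq> []" using assms(1) by simp
  show "count_list (iwords ks) = (\<lambda>\<sigma>. \<Sum>d\<leftarrow>map idat ks. fst d \<sigma>)" by (simp only: sum_idat)
  show "\<forall>\<sigma>. count_list (iwords ks) \<sigma> \<le> 1" using assms(4) by (simp only: count_list_le_1_iff)
  show "\<forall>n. Suc n < length (map idat ks) \<longrightarrow> snd (snd (map idat ks ! n)) = fst (snd (map idat ks ! Suc n))"
    "state i = fst (snd (hd (map idat ks)))" "state j = snd (snd (last (map idat ks)))"
    using assms(3) unfolding ipath_chain[OF assms(1)] by blast+
qed

text \<open>Nonzero classes have tight representatives, so a viable tensor comes from a list of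
  tight indices. The list may fail to be unique, because two indices share both their class and
  their H-data.\<close>

lemma viable_with_indices:
  assumes "viable_with M (h, s, t)" "\<forall>X\<in>set M. X \<noteq> hclass_of 0"
  obtains ks i j where "M = map icls ks" "ks \<noteq> []" "set ks \<subseteq> tight_index" "ipath i ks j"
    "distinct (iwords ks)" "h = count_list (iwords ks)" "s = state i" "t = state j"
proof -
  obtain ds where ds: "ds \<noteq> []" "list_all2 class_hdata M ds"
    "\<forall>n. Suc n < length ds \<longrightarrow> snd (snd (ds ! n)) = fst (snd (ds ! Suc n))"
    "h = (\<lambda>\<sigma>. \<Sum>d\<leftarrow>ds. fst d \<sigma>)" "\<forall>\<sigma>. h \<sigma> \<le> 1" "s = fst (snd (hd ds))" "t = snd (snd (last ds))"
    using assms(1) unfolding viable_with_def prod.case by (elim exE conjE) (rule that)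
  have "\<exists>ks. set ks \<subseteq> tight_index \<and> M = map icls ks \<and> ds = map idat ks"
    using ds(2) assms(2)
  proof (induction rule: list_all2_induct)
    case (Cons X M d ds)
    obtain h s t where d: "d = (h, s, t)" by (rule prod_cases3)
    have X: "class_hdata X (h, s, t)" "X \<noteq> hclass_of 0" using Cons d by simp_all
    obtain i a b j where k: "(i, a, b, j) \<in> tight_index" "s = state i" "t = state j"
      "h = count_list (type_word a b)" "X = hclass_of (type_vec i a b j)"
      by (rule class_hdata_nonzero[OF X])
    from Cons obtain ks where "set ks \<subseteq> tight_index \<and> M = map icls ks \<and> ds = map idat ks" by auto
    with k d show ?case
      by (intro exI[of _ "(i, a, b, j) # ks"]) (auto simp: icls_def idat_def ivec_simp iword_simp)
  qed simp
  then obtain ks where ks: "set ks \<subseteq> tight_index" "M = map icls ks" "ds = map idat ks" by blast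
  with ds(1) have ne: "ks \<noteq> []" by auto
  have h: "h = count_list (iwords ks)" using ds(4) by (simp only: ks(3) sum_idat)
  with ds(5) have "distinct (iwords ks)" by (simp only: count_list_le_1_iff)
  have st: "s = state (fst (hd ks))" "t = state (snd (snd (snd (last ks))))"
    using ds(6,7) ne by (simp_all add: ks(3) hd_map last_map idat_def)
  then have "ipath (fst (hd ks)) ks (snd (snd (snd (last ks))))"
    using ds(3,6,7) unfolding ipath_chain[OF ne] ks(3) by simp
  from that[OF ks(2) ne ks(1) this \<open>distinct (iwords ks)\<close> h st] show thesis .
qed

section \<open>Extensions and contractions\<close>

lemma ext_contr_step:
  assumes "pre @ map igen (iword k) @ post \<noteq> []"
    and "set (pre @ [k] @ post) \<subseteq> tight_index" "ipath i (pre @ [k] @ post) j"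
    and "distinct (iwords (pre @ [k] @ post))"
  shows "ext_contr (map icls (pre @ map igen (iword k) @ post)) (map icls (pre @ [k] @ post))"
proof -
  obtain i' a b j' where k: "k = (i', a, b, j')" by (rule prod_cases4)
  then have ki: "(i', a, b, j') \<in> tight_index" using assms(2) by simp
  have path: "ipath i pre i'" "ipath j' post j"
    using assms(3) by (auto simp: k ipath_append)
  have "path i' (iword k) j'" using path_index(1)[of i' a b j'] ki by (simp add: k iword_simp)
  then have "viable_with (map icls (pre @ map igen (iword k) @ post))
      (count_list (iwords (pre @ map igen (iword k) @ post)), state i, state j)"
    using assms path by (intro viable_with_icls) (auto simp: ipath_append ipath_igen)
  then have viable: "viable (map icls (pre @ map igen (iword k) @ post))"
    by (auto simp: viable_def)
  show ?thesis
  proof (cases "iword k = []")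
    case True
    \<comment> \<open>An empty word belongs to an idempotent diagram, which is inserted by an
      extension; its neighbours, where present, supply the matching state.\<close>
    then have k': "a = N0" "b = N0" "j' = i'" using iword_empty[OF ki] by (auto simp: k iword_simp)
    have u: "icls k = hclass_of (diag (state i') Map.empty (state i'))"
      using idem_vec_type[of i'] by (simp add: icls_def k k' ivec_simp idem_vec_def)
    have last: "\<exists>h s. class_hdata (last (map icls pre)) (h, s, state i')" if "pre \<noteq> []"
    proof -
      have "class_hdata (icls (last pre)) (idat (last pre))"
        using assms(2) that by (intro class_hdata_icls) auto
      moreover have "snd (snd (idat (last pre))) = state i'"
        using path(1) that unfolding ipath_chain[OF that] by (simp add: last_map)
      moreover obtain h s t where "idat (last pre) = (h, s, t)" by (rule prod_cases3)
      ultimately show ?thesis using that by (auto simp: last_map)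
    qed
    have hd: "\<exists>h t. class_hdata (hd (map icls post)) (h, state i', t)" if "post \<noteq> []"
    proof -
      have "class_hdata (icls (hd post)) (idat (hd post))"
        using assms(2) that by (intro class_hdata_icls) auto
      moreover have "fst (snd (idat (hd post))) = state i'"
        using path(2) that k' unfolding ipath_chain[OF that] by (simp add: hd_map)
      moreover obtain h s t where "idat (hd post) = (h, s, t)" by (rule prod_cases3)
      ultimately show ?thesis using that by (auto simp: hd_map)
    qed
    have "extension_step (map icls (pre @ map igen (iword k) @ post)) (map icls (pre @ [k] @ post))"
      unfolding extension_step_def
    proof (rule conjI[OF viable], rule exI[of _ "map icls pre"], rule exI[of _ "map icls post"],
        rule exI[of _ "state i'"], intro conjI)
      show "map icls (pre @ map igen (iword k) @ post) = map icls pre @ map icls post" by (simp add: True)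
      show "state i' \<subseteq> {P}" by (rule state_simps)
      show "map icls pre \<noteq> [] \<longrightarrow> (\<exists>h s. class_hdata (last (map icls pre)) (h, s, state i'))" using last by simp
      show "map icls post \<noteq> [] \<longrightarrow> (\<exists>h t. class_hdata (hd (map icls post)) (h, state i', t))" using hd by simp
      show "map icls (pre @ [k] @ post) =
          map icls pre @ [hclass_of (diag (state i') Map.empty (state i'))] @ map icls post"
        by (simp add: u)
    qed
    then show ?thesis unfolding ext_contr_def by blast
  next
    case False
    have hprod: "hprod (map icls (map igen (iword k))) = icls k"
      using hprod_word[OF ki] False by (simp add: icls_def k ivec_simp iword_simp o_def)
    have nonzero: "icls k \<noteq> hclass_of 0"
      using tight_class_nonzero[OF ki] by (simp add: icls_def k ivec_simp)
    have "contraction_step (map icls (pre @ map igen (iword k) @ post)) (map icls (pre @ [k] @ post))"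
      unfolding contraction_step_def
      by (intro conjI[OF viable], rule exI[of _ "map icls pre"],
          rule exI[of _ "map icls (map igen (iword k))"], rule exI[of _ "map icls post"])
        (use False hprod nonzero in simp)
    then show ?thesis unfolding ext_contr_def by blast
  qed
qed

lemma ext_contr_trans: "ext_contr L M \<Longrightarrow> ext_contr M N \<Longrightarrow> ext_contr L N"
  unfolding ext_contr_def by (rule rtranclp_trans)

lemma ext_contr_refl: "ext_contr M M"
  by (simp add: ext_contr_def)

text \<open>The prefix \<open>pre\<close> holds the factors already assembled, while the rest is
  still spelled in letters; each step assembles the next factor. Nonemptiness is carried along
  because a viable tensor has at least one factor.\<close>

lemma ext_contr_words:
  assumes "pre @ map igen (iwords ks) \<noteq> []"
    and "set (pre @ ks) \<subseteq> tight_index" "ipath i (pre @ ks) j" "distinct (iwords (pre @ ks))"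
  shows "ext_contr (map icls (pre @ map igen (iwords ks))) (map icls (pre @ ks))"
  using assms
proof (induction ks arbitrary: pre)
  case Nil
  then show ?case by (simp add: ext_contr_refl)
next
  case (Cons k ks)
  obtain m where m: "ipath i (pre @ [k]) m" "ipath m ks j"
    using Cons.prems(3) ipath_append[of i "pre @ [k]" ks j] by auto
  have "path m (iwords ks) j" using m(2) Cons.prems(2) by (intro path_iwords) auto
  then have "ipath i (pre @ [k] @ map igen (iwords ks)) j"
    using m(1) ipath_append[of i "pre @ [k]" "map igen (iwords ks)" j] by (auto simp: ipath_igen)
  then have "ext_contr (map icls (pre @ map igen (iword k) @ map igen (iwords ks)))
      (map icls (pre @ [k] @ map igen (iwords ks)))"
    using Cons.prems by (intro ext_contr_step) auto
  moreover have "ext_contr (map icls ((pre @ [k]) @ map igen (iwords ks))) (map icls ((pre @ [k]) @ ks))"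
    using Cons.prems by (intro Cons.IH) auto
  ultimately show ?case
    using ext_contr_trans[of _ "map icls (pre @ [k] @ map igen (iwords ks))"] by simp
qed

text \<open>The empty word cannot stand for an empty tensor, which is never viable; it stands for
  the idempotent diagram.\<close>

definition word_tensor :: "bool \<Rightarrow> step list \<Rightarrow> vec list" where
  "word_tensor i w = (if w = [] then [idem_vec i] else map gen w)"

lemma ext_contr_word_tensor:
  assumes "ks \<noteq> []" "set ks \<subseteq> tight_index" "ipath i ks j" "distinct (iwords ks)"
  shows "ext_contr (map hclass_of (word_tensor i (iwords ks))) (map icls ks)"
proof (cases "iwords ks = []")
  case False
  then have "ext_contr (map icls ([] @ map igen (iwords ks))) (map icls ([] @ ks))"
    using assms by (intro ext_contr_words) auto
  moreover have "map icls (map igen (iwords ks)) = map hclass_of (word_tensor i (iwords ks))"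
    using False by (simp add: icls_def word_tensor_def)
  ultimately show ?thesis by (simp only: append_Nil)
next
  case True
  obtain i' a b j' ks' where ks: "ks = (i', a, b, j') # ks'"
    using assms(1) by (cases ks) auto
  with True assms have k: "a = N0" "b = N0" "i' = i" "j' = i"
    using iword_empty[of i' a b j'] by (auto simp: iword_simp)
  \<comment> \<open>All factors are idempotent here. The first is kept and the others are inserted
    behind it by extensions.\<close>
  have "ext_contr (map icls ([(i, N0, N0, i)] @ map igen (iwords ks'))) (map icls ([(i, N0, N0, i)] @ ks'))"
    using assms by (intro ext_contr_words) (auto simp: ks k)
  then show ?thesis
    using True by (simp add: ks k word_tensor_def icls_def ivec_simp idem_vec_type)
qed

section \<open>Products of representatives\<close>

lemma strand_vec_type_vec [simp]: "strand_vec (type_vec i a b j)"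
  by (auto simp: strand_vec_def supp_type_vec)

lemma strand_vec_gen [simp]: "strand_vec (gen \<sigma>)"
  using strand_vec_TT by (cases \<sigma> rule: step_cases) (simp_all only: gen_TT)

lemma mult_foldl:
  assumes "strand_vec X" "strand_vec Y"
  shows "X \<odot> foldl (\<odot>) Y (map gen w) = foldl (\<odot>) (X \<odot> Y) (map gen w)"
  using assms(2)
proof (induction w arbitrary: Y)
  case (Cons \<sigma> w)
  then show ?case by (simp add: strand_vec_mult mult_assoc[OF assms(1)])
qed simp

lemma idem_vec_mult:
  assumes "(i, a, b, j) \<in> tight_index"
  shows "idem_vec i \<odot> type_vec i a b j = type_vec i a b j" "type_vec i a b j \<odot> idem_vec j = type_vec i a b j"
  using assms unfolding tight_index_def insert_iff empty_iff prod.inject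
  by (elim disjE conjE; simp add: idem_vec_type type_vec_values mult_TT mult_add_left mult_add_right)+

text \<open>Each factor is an idempotent followed by its letters, and the second assumption absorbs
  that idempotent into what has already been multiplied. The assumption is passed on because each
  diagram is fixed by its final idempotent.\<close>

lemma foldl_ivec:
  assumes "strand_vec X" "X \<odot> idem_vec i = X" "ipath i ks j" "set ks \<subseteq> tight_index"
  shows "foldl (\<odot>) X (map ivec ks) = foldl (\<odot>) X (map gen (iwords ks))"
  using assms
proof (induction ks arbitrary: X i)
  case (Cons k ks)
  obtain a b j' where k: "k = (i, a, b, j')" using Cons.prems(3) by (cases k) auto
  then have ki: "(i, a, b, j') \<in> tight_index" using Cons.prems by simp
  have "X \<odot> ivec k = X \<odot> word_val i (iword k)"
    using word_val_index[of i a b j'] ki by (simp add: k ivec_simp iword_simp)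
  also have "\<dots> = foldl (\<odot>) (X \<odot> idem_vec i) (map gen (iword k))"
    unfolding word_val_def using Cons.prems(1) by (intro mult_foldl) (simp_all add: idem_vec_type)
  finally have eq: "X \<odot> ivec k = foldl (\<odot>) X (map gen (iword k))"
    using Cons.prems(2) by simp
  have "foldl (\<odot>) (X \<odot> ivec k) (map ivec ks) = foldl (\<odot>) (X \<odot> ivec k) (map gen (iwords ks))"
  proof (rule Cons.IH)
    show "strand_vec (X \<odot> ivec k)" using Cons.prems(1) by (simp add: k ivec_simp strand_vec_mult)
    show "X \<odot> ivec k \<odot> idem_vec j' = X \<odot> ivec k"
      using mult_assoc[OF Cons.prems(1), of "ivec k" "idem_vec j'"] idem_vec_mult(2)[OF ki]
      by (simp add: k ivec_simp idem_vec_type)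
  qed (use Cons.prems k in auto)
  then show ?case by (simp add: eq)
qed simp

lemma dprod_ivec:
  assumes "ks \<noteq> []" "ipath i ks j" "set ks \<subseteq> tight_index"
  shows "dprod (map ivec ks) = word_val i (iwords ks)"
proof -
  obtain a b j' ks' where ks: "ks = (i, a, b, j') # ks'"
    using assms by (cases ks) auto
  have idem: "idem_vec i \<odot> idem_vec i = idem_vec i"
    using idem_vec_mult(1)[OF idem_index_tight, of i] by (simp add: idem_vec_type)
  have "dprod (map ivec ks) = foldl (\<odot>) (idem_vec i) (map ivec ks)"
    using idem_vec_mult(1)[of i a b j'] assms(3) by (simp add: ks dprod_def ivec_simp)
  also have "\<dots> = word_val i (iwords ks)"
    unfolding word_val_def using assms idem
    by (intro foldl_ivec) (simp_all add: idem_vec_type)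
  finally show ?thesis .
qed

text \<open>The words of the two tight diagrams that represent the same class.\<close>

definition full_words :: "step list set" where
  "full_words = {[After p, Before q, After q, Before p], [After q, Before p, After p, Before q]}"

lemma iwords_class_eq:
  assumes "list_all2 (\<lambda>k k'. icls k = icls k') ks ks'" "set ks \<subseteq> tight_index" "set ks' \<subseteq> tight_index"
    and "distinct (iwords ks)"
  shows "iwords ks = iwords ks' \<or> iwords ks \<in> full_words \<and> iwords ks' \<in> full_words"
  using assms
proof (induction rule: list_all2_induct)
  case (Cons k ks k' ks')
  have full: "set w = UNIV" if "w \<in> full_words" for w
    using that by (auto simp: full_words_def intro: step_cases)
  have kk: "k = k' \<or> iword k \<in> full_words \<and> iword k' \<in> full_words"
  proof -
    obtain i a b j where k: "k = (i, a, b, j)" by (rule prod_cases4)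
    obtain i' a' b' j' where k': "k' = (i', a', b', j')" by (rule prod_cases4)
    from k k' have "k = k' \<or> {k, k'} = {(True, D, C0, True), (True, C0, D, True)}"
      using tight_class_eq[of i a b j i' a' b' j'] Cons by (simp add: icls_def ivec_simp)
    then show ?thesis by (auto simp: doubleton_eq_iff iword_simp full_words_def)
  qed
  have IH: "iwords ks = iwords ks' \<or> iwords ks \<in> full_words \<and> iwords ks' \<in> full_words"
    using Cons by simp
  have disj: "set (iword k) \<inter> set (iwords ks) = {}" using Cons.prems by simp
  \<comment> \<open>A full word uses all four steps and no step is repeated, so the other factors
    contribute no letters; the exceptional pair never sits inside a longer word.\<close>
  have "iword k = [] \<or> iwords ks \<notin> full_words" "iwords ks = [] \<or> iword k \<notin> full_words"
    using full disj by (metis inf_top.left_neutral inf_top.right_neutral set_empty)+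
  moreover have "[] \<notin> full_words" by (simp add: full_words_def)
  ultimately show ?case using kk IH by auto
qed simp

section \<open>Classification of the words\<close>

fun walk :: "bool \<Rightarrow> place list \<Rightarrow> step list" where
  "walk i [] = []"
| "walk i (x # xs) = (if i then After x else Before x) # walk (\<not> i) xs"

lemma path_walk: "path i w j \<Longrightarrow> \<exists>xs. w = walk i xs \<and> length xs = length w"
proof (induction w arbitrary: i)
  case Nil
  then show ?case by (intro exI[of _ "[]"]) simp
next
  case (Cons \<sigma> w)
  obtain x where x: "\<sigma> = (if i then After x else Before x)" "path (\<not> i) w j"
    using Cons.prems by (cases \<sigma>) auto
  from Cons.IH[OF x(2)] obtain xs where "w = walk (\<not> i) xs \<and> length xs = length w" by blast
  with x show ?case by (intro exI[of _ "x # xs"]) simp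
qed

lemma distinct_steps_length:
  assumes "distinct (w :: step list)"
  shows "length w \<le> 4"
proof -
  have "set w \<subseteq> {Before p, Before q, After p, After q}"
    using step_cases by blast
  from card_mono[OF _ this] show ?thesis using distinct_card[OF assms] by simp
qed

text \<open>Words replace tensors here, so that occupation and tightness can be computed from
  letters. The exchange of names is the choice of \<open>x\<close> and \<open>y\<close>.\<close>

definition path_patterns :: "place \<Rightarrow> place \<Rightarrow> (bool \<times> step list \<times> bool \<times> occupation \<times> tightness) set" where
  "path_patterns x y = {
    (False, [], False, Unoccupied, Tight),
    (True, [], True, Unoccupied, Tight),
    (False, [Before x], True, Pre_one_half_occupied, Tight),
    (True, [After x], False, Post_one_half_occupied, Tight),
    (False, [Before y, After x], False, Alternately_occupied, Singular),
    (True, [After x, Before y], True, Alternately_occupied, Tight),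
    (False, [Before x, After x], False, Once_occupied, Tight),
    (True, [After x, Before x], True, Once_occupied, Twisted),
    (False, [Before x, After x, Before y], True, Pre_sesqui_occupied, Tight),
    (False, [Before y, After x, Before x], True, Pre_sesqui_occupied, Critical),
    (True, [After y, Before x, After x], False, Post_sesqui_occupied, Tight),
    (True, [After x, Before x, After y], False, Post_sesqui_occupied, Critical),
    (False, [Before x, After x, Before y, After y], False, Doubly_occupied, Tight),
    (False, [Before x, After y, Before y, After x], False, Doubly_occupied, Critical),
    (True, [After x, Before y, After y, Before x], True, Doubly_occupied, Tight),
    (True, [After x, Before x, After y, Before y], True, Doubly_occupied, Critical)}"

text \<open>States alternate along a path, so the initial state and the sequence of places determine
  the word. Four steps allow at most four letters; the sequences that repeat a step are not
  distinct, and each of the others matches a row.\<close>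

lemma path_patterns:
  assumes "path i w j" "distinct w"
  shows "\<exists>x y occ \<tau>. (x, y) \<in> {(p, q), (q, p)} \<and> (i, w, j, occ, \<tau>) \<in> path_patterns x y"
proof -
  obtain xs where xs: "w = walk i xs" "length xs = length w" using path_walk[OF assms(1)] by blast
  then have "length xs \<le> 4" using distinct_steps_length[OF assms(2)] by simp
  then consider "xs = []" | a where "xs = [a]" | a b where "xs = [a, b]" | a b c where "xs = [a, b, c]"
    | a b c d where "xs = [a, b, c, d]"
    by (auto simp: numeral_eq_Suc le_Suc_eq length_Suc_conv)
  then have "(\<exists>occ \<tau>. (i, w, j, occ, \<tau>) \<in> path_patterns p q) \<or> (\<exists>occ \<tau>. (i, w, j, occ, \<tau>) \<in> path_patterns q p)"
  proof cases
    case 1 then show ?thesis using assms unfolding xs by (cases i; simp add: path_patterns_def)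
  next
    case (2 a) then show ?thesis using assms unfolding xs by (cases i; cases a; simp add: path_patterns_def)
  next
    case (3 a b) then show ?thesis using assms unfolding xs
      by (cases i; cases a; cases b; simp add: path_patterns_def)
  next
    case (4 a b c) then show ?thesis using assms unfolding xs
      by (cases i; cases a; cases b; cases c; simp add: path_patterns_def)
  next
    case (5 a b c d) then show ?thesis using assms unfolding xs
      by (cases i; cases a; cases b; cases c; cases d; simp add: path_patterns_def)
  qed
  then show ?thesis by blast
qed

section \<open>Tightness of the words\<close>

lemma tight_diagram_TT:
  assumes "(a, b) \<in> {(N0, N0), (A, N0), (N0, A), (B, N0), (N0, B), (C0, N0), (N0, C0), (B, A), (A, B), (C0, A),
    (A, C0), (B, C0), (C0, B), (C0, C0), (D, C0), (C0, D)}"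
  shows "tight_diagram (TT a b)"
proof -
  have "\<exists>i j. (i, a, b, j) \<in> tight_index \<and> type_vec i a b j = TT a b"
    using assms unfolding insert_iff empty_iff prod.inject
    by (elim disjE conjE; simp add: tight_index_def ex_bool_eq type_vec_values)
  then show ?thesis unfolding tight_diagram_iff by metis
qed

lemma tight_diagram_idem: "tight_diagram (TT N0 N1 + TT N1 N0)"
  unfolding tight_diagram_iff using idem_index_tight[of True] type_vec_values(2) by metis

lemma twisted_diagram_TT: "twisted_diagram (TT D N0)" "twisted_diagram (TT N0 D)"
  using twisted_diagramI[of True D N0 True] twisted_diagramI[of True N0 D True]
  by (simp_all add: twisted_index_def type_vec_values)

lemma tight_nonzero: "tight_diagram X \<Longrightarrow> X \<noteq> 0"
  by (auto simp: tight_diagram_def)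

lemma TT_nonzero: "TT a b \<noteq> 0"
  by (metis coeff_TT coeff_zero zero_neq_one)

lemma summand_nonzero:
  assumes "(i, a, b, j) \<in> diagram_index" "h = count_list (type_word a b)"
  shows "summand (h, state i, state j) \<noteq> {0}"
proof -
  have "diagram_hdata (type_vec i a b j) (h, state i, state j)"
    using assms diagram_hdata_index by blast
  then have "type_vec i a b j \<in> summand (h, state i, state j)"
    by (simp add: summand_def span2_base)
  with index_type_vec_nonzero[OF assms(1)] show ?thesis by blast
qed

lemma summand_zero:
  assumes "\<And>a b. (i, a, b, j) \<in> diagram_index \<Longrightarrow> h \<noteq> count_list (type_word a b)"
  shows "summand (h, state i, state j) = {0}"
proof -
  have "\<not> diagram_hdata X (h, state i, state j)" for X
    unfolding diagram_hdata_index state_simps using assms by blast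
  then have "summand (h, state i, state j) = span2 {}" by (simp add: summand_def)
  then show ?thesis by (simp add: span2_def)
qed

text \<open>With the pair off at both ends no moving strand starts or stops at a place, so each
  interval is covered entirely or not at all. Here exactly one of the two steps at \<open>p\<close>
  is covered.\<close>

lemma summand_alternating:
  assumes "x \<noteq> y"
  shows "summand (count_list [Before y, After x], state False, state False) = {0}"
proof (rule summand_zero)
  fix a b assume "(False, a, b, False) \<in> diagram_index"
  then have "count_list (type_word a b) (Before p) = count_list (type_word a b) (After p)"
    unfolding index_defs Un_iff insert_iff empty_iff prod.inject
    by (elim disjE conjE; simp)
  moreover have "count_list [Before y, After x] (Before p) \<noteq> count_list [Before y, After x] (After p)"
    using assms by (cases x; cases y) auto
  ultimately show "count_list [Before y, After x] \<noteq> count_list (type_word a b)" by metis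
qed

definition classified :: "place \<Rightarrow> place \<Rightarrow> (occupation \<times> (bool \<times> bool) \<times> tightness \<times> vec list) set" where
  "classified x y =
     {(Unoccupied, (False, False), Tight, [e0]),
      (Unoccupied, (True, True), Tight, [e1]),
      (Pre_one_half_occupied, (False, True), Tight, [minus_strand x]),
      (Post_one_half_occupied, (True, False), Tight, [plus_strand x]),
      (Alternately_occupied, (False, False), Singular, [minus_strand y, plus_strand x]),
      (Alternately_occupied, (True, True), Tight, [plus_strand x, minus_strand y]),
      (Once_occupied, (False, False), Tight, [minus_strand x, plus_strand x]),
      (Once_occupied, (True, True), Twisted, [plus_strand x, minus_strand x]),
      (Pre_sesqui_occupied, (False, True), Tight,
        [minus_strand x, plus_strand x, minus_strand y]),
      (Pre_sesqui_occupied, (False, True), Critical,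
        [minus_strand y, plus_strand x, minus_strand x]),
      (Post_sesqui_occupied, (True, False), Tight,
        [plus_strand y, minus_strand x, plus_strand x]),
      (Post_sesqui_occupied, (True, False), Critical,
        [plus_strand x, minus_strand x, plus_strand y]),
      (Doubly_occupied, (False, False), Tight,
        [minus_strand x, plus_strand x, minus_strand y, plus_strand y]),
      (Doubly_occupied, (False, False), Critical,
        [minus_strand x, plus_strand y, minus_strand y, plus_strand x]),
      (Doubly_occupied, (True, True), Tight,
        [plus_strand x, minus_strand y, plus_strand y, minus_strand x]),
      (Doubly_occupied, (True, True), Critical,
        [plus_strand x, minus_strand x, plus_strand y, minus_strand y])}"

lemmas occupation_defs = unoccupied_def pre_half_occupied_def post_half_occupied_def half_occupied_def
  fully_occupied_def

lemma pattern_classified: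
  assumes "(i, w, j, occ, \<tau>) \<in> path_patterns x y" "x \<noteq> y"
  shows "(occ, (i, j), \<tau>, word_tensor i w) \<in> classified x y"
  using assms unfolding path_patterns_def insert_iff empty_iff prod.inject
  by (elim disjE conjE; simp add: word_tensor_def e0_idem_vec e1_idem_vec gen.simps classified_def)

lemma pattern_occupation:
  assumes "(i, w, j, occ, \<tau>) \<in> path_patterns x y" "(x, y) \<in> {(p, q), (q, p)}"
  shows "occupation_of_P (count_list w) occ"
  using assms unfolding path_patterns_def insert_iff empty_iff prod.inject
  by (elim disjE conjE; simp add: occupation_defs all_place ex_place)

text \<open>Tightness is decided by the product and the H-data alone, so the one-element list
  holding the product of the letters stands for every list of representatives with that
  product.\<close>

lemma pattern_tightness:
  assumes "(i, w, j, occ, \<tau>) \<in> path_patterns x y" "(x, y) \<in> {(p, q), (q, p)}"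
  shows "tightness_via [word_val i w] (count_list w, state i, state j) \<tau>"
proof -
  have critical: "summand (h, state i, state j) \<noteq> {0}"
    if "(i, a, b, j) \<in> diagram_index" "\<forall>\<sigma>. h \<sigma> = count_list (type_word a b) \<sigma>" for h i a b j
    using summand_nonzero[OF that(1), of h] that(2) by blast
  \<comment> \<open>These are the four critical patterns in both orientations. Each word with zero
    product covers the same steps, between the same states, as the tight diagram named here.\<close>
  have summand1: "summand (count_list [Before q, After p, Before p], state False, state True) \<noteq> {0}"
    by (rule critical[of _ C0 A]; simp add: index_defs all_step)
  have summand2: "summand (count_list [Before p, After q, Before q], state False, state True) \<noteq> {0}"
    by (rule critical[of _ A C0]; simp add: index_defs all_step)
  have summand3: "summand (count_list [After p, Before p, After q], state True, state False) \<noteq> {0}"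
    by (rule critical[of _ C0 B]; simp add: index_defs all_step)
  have summand4: "summand (count_list [After q, Before q, After p], state True, state False) \<noteq> {0}"
    by (rule critical[of _ B C0]; simp add: index_defs all_step)
  have summand5: "summand (count_list [Before p, After q, Before q, After p], state False, state False) \<noteq> {0}"
    by (rule critical[of _ C0 C0]; simp add: index_defs all_step)
  have summand6: "summand (count_list [Before q, After p, Before p, After q], state False, state False) \<noteq> {0}"
    by (rule critical[of _ C0 C0]; simp add: index_defs all_step)
  have summand7: "summand (count_list [After p, Before p, After q, Before q], state True, state True) \<noteq> {0}"
    by (rule critical[of _ D C0]; simp add: index_defs all_step)
  have summand8: "summand (count_list [After q, Before q, After p, Before p], state True, state True) \<noteq> {0}"
    by (rule critical[of _ D C0]; simp add: index_defs all_step)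
  note summands = summand1 summand2 summand3 summand4 summand5 summand6 summand7 summand8
  show ?thesis
    using assms unfolding path_patterns_def insert_iff empty_iff prod.inject
    by (elim disjE conjE; simp add: dprod_def word_val_def idem_vec_type type_vec_values gen_TT mult_TT mult_add_left
        tight_diagram_TT tight_diagram_idem twisted_diagram_TT TT_nonzero tight_nonzero[OF tight_diagram_idem]
        summands summand_alternating del: count_list.simps)
qed

lemma full_word_val:
  assumes "w \<in> full_words"
  shows "tight_diagram (word_val True w)"
  using assms unfolding full_words_def
  by (auto simp: word_val_def idem_vec_type type_vec_values gen_TT mult_TT mult_add_left tight_diagram_TT)

section \<open>Independence of the representatives\<close>

lemma tightness_via_cong:
  "dprod Ds = dprod Ds' \<Longrightarrow> tightness_via Ds dat \<tau> \<longleftrightarrow> tightness_via Ds' dat \<tau>"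
  by (cases \<tau>) simp_all

text \<open>A tight product is incompatible with \<open>Twisted\<close> and \<open>Critical\<close>,
  and \<open>Singular\<close> depends on the H-data alone; so two tight products are
  interchangeable.\<close>

lemma tightness_via_tight:
  assumes "tightness_via Ds dat \<tau>" "tight_diagram (dprod Ds)" "tight_diagram (dprod Ds')"
  shows "tightness_via Ds' dat \<tau>"
  using assms tight_nonzero by (cases \<tau>) (auto simp: tight_diagram_def twisted_diagram_def)

lemma representsE:
  assumes "represents Ds M"
  obtains ks where "Ds = map ivec ks" "set ks \<subseteq> tight_index" "M = map icls ks"
proof -
  have "\<exists>ks. Ds = map ivec ks \<and> set ks \<subseteq> tight_index \<and> M = map icls ks"
    using assms unfolding represents_def
  proof (induction rule: list_all2_induct)
    case (Cons X Ds C M)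
    then obtain i a b j where "(i, a, b, j) \<in> tight_index" "X = type_vec i a b j" "C = hclass_of X"
      by (auto simp: tight_diagram_iff)
    moreover from Cons obtain ks where "Ds = map ivec ks \<and> set ks \<subseteq> tight_index \<and> M = map icls ks" by blast
    ultimately show ?case
      by (intro exI[of _ "(i, a, b, j) # ks"]) (simp add: ivec_simp icls_def)
  qed simp
  with that show thesis by blast
qed

text \<open>The exceptional pair of homologous diagrams also shares its initial and final
  state.\<close>

lemma ipath_class_eq:
  assumes "list_all2 (\<lambda>k k'. icls k = icls k') ks ks'" "set ks \<subseteq> tight_index" "set ks' \<subseteq> tight_index"
    and "ipath i ks j"
  shows "ipath i ks' j"
  using assms
proof (induction arbitrary: i rule: list_all2_induct)
  case (Cons k ks k' ks')
  obtain i1 a b j1 where k: "k = (i1, a, b, j1)" by (rule prod_cases4)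
  obtain i2 a' b' j2 where k': "k' = (i2, a', b', j2)" by (rule prod_cases4)
  have "i1 = i2 \<and> j1 = j2"
    using tight_class_eq[of i1 a b j1 i2 a' b' j2] Cons.hyps Cons.prems
    by (auto simp: k k' icls_def ivec_simp doubleton_eq_iff)
  with Cons show ?case by (simp add: k k')
qed simp

text \<open>Changing representatives either keeps the concatenated word or exchanges the two full
  words, whose products are both tight.\<close>

lemma tensor_tightness_icls:
  assumes ks: "ks \<noteq> []" "set ks \<subseteq> tight_index" "ipath i ks j" "distinct (iwords ks)"
    and \<tau>: "tightness_via [word_val i (iwords ks)] (count_list (iwords ks), state i, state j) \<tau>"
  shows "tensor_tightness (map icls ks) (count_list (iwords ks), state i, state j) \<tau>"
  unfolding tensor_tightness_def
proof (intro conjI allI impI)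
  let ?dat = "(count_list (iwords ks), state i, state j)"
  show "viable_with (map icls ks) ?dat" by (rule viable_with_icls[OF ks])
  have "tight_diagram (ivec k)" if "k \<in> set ks" for k
  proof -
    obtain i a b j where k: "k = (i, a, b, j)" by (rule prod_cases4)
    with that ks(2) have "(i, a, b, j) \<in> tight_index" by blast
    then show ?thesis unfolding tight_diagram_iff k ivec_simp by blast
  qed
  then have "represents (map ivec ks) (map icls ks)"
    unfolding represents_def list_all2_map1 list_all2_map2 icls_def
    by (intro list.rel_refl_strong) simp
  then show "\<exists>Ds. represents Ds (map icls ks)" by blast
  fix Ds assume "represents Ds (map icls ks)"
  then obtain ks' where ks': "Ds = map ivec ks'" "set ks' \<subseteq> tight_index" "map icls ks = map icls ks'"
    by (rule representsE)
  have rel: "list_all2 (\<lambda>k k'. icls k = icls k') ks ks'"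
    using ks'(3) by (simp add: list_all2_conv_all_nth list_eq_iff_nth_eq)
  have "ks' \<noteq> []" using ks(1) ks'(3) by auto
  then have val: "dprod Ds = word_val i (iwords ks')"
    unfolding ks'(1) by (rule dprod_ivec[OF _ ipath_class_eq[OF rel ks(2) ks'(2) ks(3)] ks'(2)])
  have single: "dprod [X] = X" for X by (simp add: dprod_def)
  from iwords_class_eq[OF rel ks(2) ks'(2) ks(4)] show "tightness_via Ds ?dat \<tau>"
  proof
    assume "iwords ks = iwords ks'"
    with \<tau> val single show ?thesis using tightness_via_cong[of Ds "[word_val i (iwords ks')]"] by metis
  next
    assume full: "iwords ks \<in> full_words \<and> iwords ks' \<in> full_words"
    \<comment> \<open>Both full words begin with a strand leaving a place, so the pair is initially
      on.\<close>
    moreover have "i = True"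
      using path_iwords[OF ks(3,2)] full by (auto simp: full_words_def)
    ultimately show ?thesis
      using tightness_via_tight[OF \<tau>, of Ds] full_word_val val single by metis
  qed
qed

theorem proposition4p23:
  fixes M :: tensor
  assumes "viable M"
    and "\<forall>X \<in> set M. X \<noteq> hclass_of 0"
  shows "\<exists>x y occ st \<tau> N dat.
    (x, y) \<in> {(p, q), (q, p)} \<and>
    (occ, st, \<tau>, N) \<in>
     {(Unoccupied, (False, False), Tight, [e0]),
      (Unoccupied, (True, True), Tight, [e1]),
      (Pre_one_half_occupied, (False, True), Tight, [minus_strand x]),
      (Post_one_half_occupied, (True, False), Tight, [plus_strand x]),
      (Alternately_occupied, (False, False), Singular, [minus_strand y, plus_strand x]),
      (Alternately_occupied, (True, True), Tight, [plus_strand x, minus_strand y]),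
      (Once_occupied, (False, False), Tight, [minus_strand x, plus_strand x]),
      (Once_occupied, (True, True), Twisted, [plus_strand x, minus_strand x]),
      (Pre_sesqui_occupied, (False, True), Tight,
        [minus_strand x, plus_strand x, minus_strand y]),
      (Pre_sesqui_occupied, (False, True), Critical,
        [minus_strand y, plus_strand x, minus_strand x]),
      (Post_sesqui_occupied, (True, False), Tight,
        [plus_strand y, minus_strand x, plus_strand x]),
      (Post_sesqui_occupied, (True, False), Critical,
        [plus_strand x, minus_strand x, plus_strand y]),
      (Doubly_occupied, (False, False), Tight,
        [minus_strand x, plus_strand x, minus_strand y, plus_strand y]),
      (Doubly_occupied, (False, False), Critical,
        [minus_strand x, plus_strand y, minus_strand y, plus_strand x]),
      (Doubly_occupied, (True, True), Tight,
        [plus_strand x, minus_strand y, plus_strand y, minus_strand x]),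
      (Doubly_occupied, (True, True), Critical,
        [plus_strand x, minus_strand x, plus_strand y, minus_strand y])} \<and>
    ext_contr (map hclass_of N) M \<and>
    viable_with M dat \<and> has_hdata_type dat occ st \<and> tensor_tightness M dat \<tau>"
proof -
  obtain h s t where "viable_with M (h, s, t)"
    using assms(1) unfolding viable_def by (metis prod_cases3)
  from viable_with_indices[OF this assms(2)]
  obtain ks i j where M: "M = map icls ks"
    and ks: "ks \<noteq> []" "set ks \<subseteq> tight_index" "ipath i ks j" "distinct (iwords ks)" by metis
  let ?w = "iwords ks"
  let ?dat = "(count_list ?w, state i, state j)"
  obtain x y occ \<tau> where xy: "(x, y) \<in> {(p, q), (q, p)}" and w: "(i, ?w, j, occ, \<tau>) \<in> path_patterns x y"
    using path_patterns[OF path_iwords[OF ks(3,2)] ks(4)] by blast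
  from xy have "x \<noteq> y" by auto
  note row = pattern_classified[OF w this, unfolded classified_def]
  have ext: "ext_contr (map hclass_of (word_tensor i ?w)) M"
    unfolding M by (rule ext_contr_word_tensor[OF ks])
  have viable: "viable_with M ?dat"
    unfolding M by (rule viable_with_icls[OF ks])
  have hdata: "has_hdata_type ?dat occ (i, j)"
    using pattern_occupation[OF w xy] by simp
  have tightness: "tensor_tightness M ?dat \<tau>"
    unfolding M by (rule tensor_tightness_icls[OF ks pattern_tightness[OF w xy]])
  show ?thesis
    by (rule exI[of _ x], rule exI[of _ y], rule exI[of _ occ], rule exI[of _ "(i, j)"], rule exI[of _ \<tau>],
        rule exI[of _ "word_tensor i ?w"], rule exI[of _ ?dat]) (intro conjI xy row ext viable hdata tightness)
qed

end
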